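(* Let $\Gamma=\mathrm{PSL}_2(\mathbb Z)$ act on the upper half-plane $\mathbf H^2$ by Möbius transformations, and let $\Omega=\Gamma e^{i\pi/3}$, which is the vertex set of the Serre tree $T$. Then the group $\mathrm{phi}(\Omega)$ of all piecewise $\Gamma$-isometric permutations of $\Omega$ coincides with the group $\mathrm{ppti}(\Omega)$ of all piecewise planar tree-isometric permutations of the vertex set $\Omega$ of $T$.
   Context: Let $H=\{z\in\mathbf H^2:|z|\ge1\}$, $H'=\{z\in\mathbf H^2:\mathrm{Re}(z)\le\frac12\}$, $H''=\{z\in\mathbf H^2:\mathrm{Re}(z)\ge-\frac12\}$; $D=H\cap H'\cap H''$ is the standard fundamental polyhedron of $\Gamma$. $D$ has exactly one finite edge $e$ (the arc of $|z|=1$ from $e^{2\pi i/3}$ to $e^{i\pi/3}$). The Serre tree is $T=\bigcup_{\gamma\in\Gamma}\gamma e$; it is a tree embedded in the plane with vertex set $\Omega=\Gamma e^{i\pi/3}$ and all vertices of degree 3, and $\Gamma$ acts on it. A convex $\Gamma$-polyhedral subset of $\mathbf H^2$ is a finite intersection of $\Gamma$-translates of the half-planes $H,H',H''$. A convex $\Gamma$-polyhedral piece of $\Omega$ is a set $\Omega\cap P$ with $P$ convex $\Gamma$-polyhedral. $\mathrm{phi}(\Omega)$ is the group of all permutations $g$ of $\Omega$ such that $\Omega$ is a union of finitely many convex $\Gamma$-polyhedral pieces $S_1,\dots,S_k$ such that, for each $i$, $g|_{S_i}$ is the restriction of some element of $\Gamma$. $\mathrm{ppti}(\Omega)$ is the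 group of all permutations of $\Omega=\mathrm{ver}(T)$ which respect all but finitely many edges of $T$ (i.e. map the endpoints of the edge to the endpoints of an edge) and respect the cyclic orientation (induced by the orientation of the plane) of the links of all but finitely many vertices of $T$. *)

theory Defs
  imports "HOL-Analysis.Analysis" "HOL-Algebra.Group_Action"
begin

section \<open>The modular group acting on the upper half-plane\<close>

definition UHP :: "complex set" where
  "UHP = {z. Im z > 0}"

definition SL2Z :: "(int ^ 2 ^ 2) monoid" where
  "SL2Z = \<lparr>carrier = {A. det A = 1}, mult = (**), one = mat 1\<rparr>"

definition PSL2Z :: "(int ^ 2 ^ 2) set monoid" where
  "PSL2Z = SL2Z Mod {mat 1, - mat 1}"

definition moebius_map :: "int ^ 2 ^ 2 \<Rightarrow> complex \<Rightarrow> complex" where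
  "moebius_map A z = (of_int (A $ 1 $ 1) * z + of_int (A $ 1 $ 2)) /
                 (of_int (A $ 2 $ 1) * z + of_int (A $ 2 $ 2))"

text \<open>
  The elements of \<^const>\<open>PSL2Z\<close> are the cosets \<open>{A, - A}\<close>, and \<open>A\<close> and \<open>- A\<close> induce the same
  transformation, so the choice of the representative is irrelevant
  (lemma \<open>psl_act_coset\<close> below).  The maps are extensional on \<^const>\<open>UHP\<close>, as required
  by the locale \<^locale>\<open>group_action\<close>.
\<close>

definition psl_act :: "(int ^ 2 ^ 2) set \<Rightarrow> complex \<Rightarrow> complex" where
  "psl_act C = (\<lambda>z\<in>UHP. moebius_map (SOME A. A \<in> C) z)"

definition Omega :: "complex set" where
  "Omega = orbit PSL2Z psl_act (cis (pi / 3))"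


section \<open>The Serre tree\<close>

definition base_edge :: "complex set" where
  "base_edge = cis ` {pi / 3 .. 2 * pi / 3}"

definition tree_edges :: "complex set set" where
  "tree_edges = {psl_act C ` base_edge | C. C \<in> carrier PSL2Z}"

text \<open>
  An edge meets the vertex set exactly in its two endpoints (lemma \<open>edge_ends_translate\<close> below).
\<close>

definition edge_ends :: "complex set \<Rightarrow> complex set" where
  "edge_ends E = E \<inter> Omega"

text \<open>The arc \<open>E\<close> leaves its endpoint \<open>v\<close> in the direction of angle \<open>t\<close>.\<close>

definition departs :: "complex set \<Rightarrow> complex \<Rightarrow> real \<Rightarrow> bool" where
  "departs E v t \<longleftrightarrow> ((\<lambda>z. sgn (z - v)) \<longlongrightarrow> cis t) (at v within E)"

text \<open>
  The cyclic orientation of the link of \<open>v\<close>, as a ternary relation: \<open>a\<close>, \<open>b\<close>, \<open>c\<close> are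
  neighbours of \<open>v\<close> in the tree, and the edges joining \<open>v\<close> to them follow each other
  counterclockwise around \<open>v\<close> in this cyclic order.
\<close>

definition link_ccw :: "complex \<Rightarrow> complex \<Rightarrow> complex \<Rightarrow> complex \<Rightarrow> bool" where
  "link_ccw v a b c \<longleftrightarrow>
     (\<exists>A\<in>tree_edges. \<exists>B\<in>tree_edges. \<exists>C\<in>tree_edges.
        edge_ends A = {v, a} \<and> edge_ends B = {v, b} \<and> edge_ends C = {v, c} \<and>
        (\<exists>r s t. r < s \<and> s < t \<and> t < r + 2 * pi \<and>
           departs A v r \<and> departs B v s \<and> departs C v t))"


section \<open>Piecewise isometric permutations\<close>

definition base_halfplanes :: "complex set set" where
  "base_halfplanes =
     {{z \<in> UHP. cmod z \<ge> 1}, {z \<in> UHP. Re z \<le> 1 / 2}, {z \<in> UHP. Re z \<ge> - 1 / 2}}"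

definition halfplanes :: "complex set set" where
  "halfplanes = {psl_act C ` K | C K. C \<in> carrier PSL2Z \<and> K \<in> base_halfplanes}"

definition convex_polyhedral :: "complex set \<Rightarrow> bool" where
  "convex_polyhedral P \<longleftrightarrow> (\<exists>F. finite F \<and> F \<subseteq> halfplanes \<and> P = UHP \<inter> \<Inter>F)"

definition polyhedral_piece :: "complex set \<Rightarrow> bool" where
  "polyhedral_piece S \<longleftrightarrow> (\<exists>P. convex_polyhedral P \<and> S = Omega \<inter> P)"

definition piecewise_isometric :: "(complex \<Rightarrow> complex) \<Rightarrow> bool" where
  "piecewise_isometric g \<longleftrightarrow>
     (\<exists>\<S>. finite \<S> \<and> \<Union>\<S> = Omega \<and>
        (\<forall>S\<in>\<S>. polyhedral_piece S \<and> (\<exists>C\<in>carrier PSL2Z. \<forall>z\<in>S. g z = psl_act C z)))"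

definition phi :: "(complex \<Rightarrow> complex) monoid" where
  "phi = BijGroup Omega \<lparr>carrier := {g \<in> carrier (BijGroup Omega). piecewise_isometric g}\<rparr>"


section \<open>Piecewise planar tree-isometric permutations\<close>

definition respects_edge :: "(complex \<Rightarrow> complex) \<Rightarrow> complex set \<Rightarrow> bool" where
  "respects_edge g E \<longleftrightarrow> (\<exists>E'\<in>tree_edges. g ` edge_ends E = edge_ends E')"

definition respects_link :: "(complex \<Rightarrow> complex) \<Rightarrow> complex \<Rightarrow> bool" where
  "respects_link g v \<longleftrightarrow>
     (\<forall>a b c. link_ccw v a b c \<longrightarrow> link_ccw (g v) (g a) (g b) (g c))"

definition ppti :: "(complex \<Rightarrow> complex) monoid" where
  "ppti = BijGroup Omega \<lparr>carrier := {g \<in> carrier (BijGroup Omega).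
     finite {E \<in> tree_edges. \<not> respects_edge g E} \<and>
     finite {v \<in> Omega. \<not> respects_link g v}}\<rparr>"


section \<open>Well-definedness\<close>

lemma mat2_eq_iff:
  fixes A B :: "'a ^ 2 ^ 2"
  shows "A = B \<longleftrightarrow> A $ 1 $ 1 = B $ 1 $ 1 \<and> A $ 1 $ 2 = B $ 1 $ 2 \<and>
                    A $ 2 $ 1 = B $ 2 $ 1 \<and> A $ 2 $ 2 = B $ 2 $ 2"
  by (auto simp: vec_eq_iff forall_2)

lemma mat2_mult_nth:
  fixes A B :: "int ^ 2 ^ 2"
  shows "(A ** B) $ i $ j = A $ i $ 1 * B $ 1 $ j + A $ i $ 2 * B $ 2 $ j"
  by (simp add: matrix_matrix_mult_def sum_2)

lemma group_SL2Z: "group SL2Z"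
proof (rule groupI)
  fix A assume "A \<in> carrier SL2Z"
  then have d: "A $ 1 $ 1 * A $ 2 $ 2 - A $ 1 $ 2 * A $ 2 $ 1 = 1"
    by (simp add: SL2Z_def det_2)
  define B :: "int ^ 2 ^ 2" where
    "B = vector [vector [A $ 2 $ 2, - A $ 1 $ 2], vector [- A $ 2 $ 1, A $ 1 $ 1]]"
  have "B \<in> carrier SL2Z" "B \<otimes>\<^bsub>SL2Z\<^esub> A = \<one>\<^bsub>SL2Z\<^esub>"
    using d by (simp_all add: SL2Z_def det_2 B_def mat2_eq_iff mat2_mult_nth mat_def algebra_simps)
  then show "\<exists>B\<in>carrier SL2Z. B \<otimes>\<^bsub>SL2Z\<^esub> A = \<one>\<^bsub>SL2Z\<^esub>" by blast
qed (auto simp: SL2Z_def det_mul matrix_mul_assoc)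

lemma neg_mat2_mult:
  fixes A B :: "int ^ 2 ^ 2"
  shows "(- A) ** B = - (A ** B)" "A ** (- B) = - (A ** B)"
  by (simp_all add: mat2_eq_iff mat2_mult_nth)

lemma det_neg_mat2_one: "det (- mat 1 :: int ^ 2 ^ 2) = 1"
  by (simp add: det_2 mat_def)

lemma normal_center: "{mat 1, - mat 1} \<lhd> SL2Z"
proof -
  interpret group SL2Z by (rule group_SL2Z)
  have inv: "inv\<^bsub>SL2Z\<^esub> (- mat 1) = (- mat 1 :: int ^ 2 ^ 2)"
    by (rule inv_equality) (simp_all add: SL2Z_def neg_mat2_mult det_neg_mat2_one)
  have one: "\<one>\<^bsub>SL2Z\<^esub> = mat 1" by (simp add: SL2Z_def)
  have "subgroup {mat 1, - mat 1} SL2Z"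
  proof (rule subgroupI)
    show "inv\<^bsub>SL2Z\<^esub> a \<in> {mat 1, - mat 1}" if "a \<in> {mat 1, - mat 1}" for a
      using that inv inv_one one by auto
  qed (auto simp: SL2Z_def neg_mat2_mult det_neg_mat2_one)
  then show ?thesis
    by (rule normalI) (auto simp: l_coset_def r_coset_def SL2Z_def neg_mat2_mult)
qed

lemma group_PSL2Z: "group PSL2Z"
  unfolding PSL2Z_def by (rule normal.factorgroup_is_group[OF normal_center])

lemma SL2Z_coset: "{mat 1, - mat 1} #>\<^bsub>SL2Z\<^esub> A = {A, - A}"
  by (auto simp: r_coset_def SL2Z_def neg_mat2_mult)

lemma carrier_PSL2Z: "carrier PSL2Z = {{A, - A} | A. det A = 1}"
  unfolding PSL2Z_def carrier_FactGroup SL2Z_coset by (auto simp: SL2Z_def)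

lemma moebius_uminus: "moebius_map (- A) z = moebius_map A z"
proof -
  have "of_int ((- A) $ i $ 1) * z + of_int ((- A) $ i $ 2) =
          - (of_int (A $ i $ 1) * z + of_int (A $ i $ 2))" for i by simp
  then show ?thesis unfolding moebius_map_def by (simp only: minus_divide_divide)
qed

lemma psl_act_coset: "psl_act {A, - A} = (\<lambda>z\<in>UHP. moebius_map A z)"
proof -
  have "(SOME B. B \<in> {A, - A}) \<in> {A, - A}" by (rule someI[of _ A]) simp
  then show ?thesis unfolding psl_act_def by (auto simp: moebius_uminus)
qed

lemma moebius_denom_nz:
  fixes A :: "int ^ 2 ^ 2"
  assumes "det A = 1" "z \<in> UHP"
  shows "of_int (A $ 2 $ 1) * z + of_int (A $ 2 $ 2) \<noteq> 0"
proof
  assume 0: "of_int (A $ 2 $ 1) * z + of_int (A $ 2 $ 2) = 0"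
  then have "A $ 2 $ 1 = 0" using assms(2) by (auto simp: complex_eq_iff UHP_def)
  with 0 have "A $ 2 $ 2 = 0" by simp
  with \<open>A $ 2 $ 1 = 0\<close> assms(1) show False by (simp add: det_2)
qed

lemma Im_moebius:
  assumes "det A = 1"
  shows "Im (moebius_map A z) = Im z / (cmod (of_int (A $ 2 $ 1) * z + of_int (A $ 2 $ 2)))\<^sup>2"
proof -
  have "real_of_int (A $ 1 $ 1) * real_of_int (A $ 2 $ 2)
          - real_of_int (A $ 1 $ 2) * real_of_int (A $ 2 $ 1) = 1"
    using assms unfolding det_2 by (metis of_int_1 of_int_diff of_int_mult)
  then have "real_of_int (A $ 1 $ 1) * Im z * (real_of_int (A $ 2 $ 1) * Re z + real_of_int (A $ 2 $ 2))
     - (real_of_int (A $ 1 $ 1) * Re z + real_of_int (A $ 1 $ 2)) * (real_of_int (A $ 2 $ 1) * Im z) = Im z"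
    by algebra
  then show ?thesis
    by (simp add: moebius_map_def Im_divide cmod_power2)
qed

lemma moebius_in_UHP: "det A = 1 \<Longrightarrow> z \<in> UHP \<Longrightarrow> moebius_map A z \<in> UHP"
  using moebius_denom_nz[of A z] Im_moebius[of A z] by (simp add: UHP_def)

lemma moebius_mult:
  assumes "det A = 1" "det B = 1" "z \<in> UHP"
  shows "moebius_map (A ** B) z = moebius_map A (moebius_map B z)"
proof -
  define p where "p = of_int (B $ 1 $ 1) * z + of_int (B $ 1 $ 2)"
  define q where "q = of_int (B $ 2 $ 1) * z + of_int (B $ 2 $ 2)"
  have q: "q \<noteq> 0" using moebius_denom_nz[OF assms(2,3)] by (simp add: q_def)
  have "moebius_map A (moebius_map B z) = (of_int (A $ 1 $ 1) * (p / q) + of_int (A $ 1 $ 2)) /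
          (of_int (A $ 2 $ 1) * (p / q) + of_int (A $ 2 $ 2))"
    by (simp add: moebius_map_def p_def q_def)
  also have "\<dots> = (of_int (A $ 1 $ 1) * p + of_int (A $ 1 $ 2) * q) /
          (of_int (A $ 2 $ 1) * p + of_int (A $ 2 $ 2) * q)"
    using q by (simp add: divide_simps)
  also have "\<dots> = moebius_map (A ** B) z"
    by (simp add: moebius_map_def p_def q_def mat2_mult_nth algebra_simps)
  finally show ?thesis ..
qed

lemma moebius_one: "moebius_map (mat 1) z = z"
  by (simp add: moebius_map_def mat_def)

lemma PSL2Z_mult:
  assumes "det A = 1" "det B = 1"
  shows "{A, - A} \<otimes>\<^bsub>PSL2Z\<^esub> {B, - B} = {A ** B, - (A ** B)}"
  using assms by (auto simp: PSL2Z_def FactGroup_def set_mult_def SL2Z_def neg_mat2_mult)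

lemma psl_act_closed: "C \<in> carrier PSL2Z \<Longrightarrow> z \<in> UHP \<Longrightarrow> psl_act C z \<in> UHP"
  by (auto simp: carrier_PSL2Z psl_act_coset moebius_in_UHP)

lemma psl_act_mult:
  assumes "C \<in> carrier PSL2Z" "D \<in> carrier PSL2Z" "z \<in> UHP"
  shows "psl_act (C \<otimes>\<^bsub>PSL2Z\<^esub> D) z = psl_act C (psl_act D z)"
  using assms
  by (auto simp: carrier_PSL2Z PSL2Z_mult psl_act_coset moebius_mult moebius_in_UHP)

lemma psl_act_one: "z \<in> UHP \<Longrightarrow> psl_act \<one>\<^bsub>PSL2Z\<^esub> z = z"
  using psl_act_coset[of "mat 1"] by (simp add: PSL2Z_def FactGroup_def moebius_one)

lemma psl_act_Bij: assumes C: "C \<in> carrier PSL2Z" shows "psl_act C \<in> Bij UHP"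
proof -
  interpret group PSL2Z by (rule group_PSL2Z)
  have "bij_betw (psl_act C) UHP UHP"
    by (rule bij_betw_byWitness[where f' = "psl_act (inv\<^bsub>PSL2Z\<^esub> C)"])
       (use C in \<open>auto simp: psl_act_closed psl_act_one simp flip: psl_act_mult\<close>)
  then show ?thesis by (simp add: Bij_def psl_act_def)
qed

lemma group_action_PSL2Z: "group_action PSL2Z UHP psl_act"
proof (intro group_action.intro group_hom.intro group_hom_axioms.intro group_PSL2Z group_BijGroup homI)
  fix C D assume C: "C \<in> carrier PSL2Z" and D: "D \<in> carrier PSL2Z"
  interpret group PSL2Z by (rule group_PSL2Z)
  show "psl_act (C \<otimes>\<^bsub>PSL2Z\<^esub> D) = psl_act C \<otimes>\<^bsub>BijGroup UHP\<^esub> psl_act D"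
  proof
    fix z
    show "psl_act (C \<otimes>\<^bsub>PSL2Z\<^esub> D) z = (psl_act C \<otimes>\<^bsub>BijGroup UHP\<^esub> psl_act D) z"
      using C D
      by (cases "z \<in> UHP") (simp_all add: BijGroup_def psl_act_Bij compose_def psl_act_mult,
                            simp add: psl_act_def)
  qed
qed (simp add: BijGroup_def psl_act_Bij)

lemma cis_third_in_UHP: "cis (pi / 3) \<in> UHP"
  by (simp add: UHP_def sin_60)

lemma Omega_subset_UHP: "Omega \<subseteq> UHP"
  using psl_act_closed cis_third_in_UHP by (auto simp: Omega_def orbit_def)

lemma psl_act_Omega:
  assumes "C \<in> carrier PSL2Z" "z \<in> Omega" shows "psl_act C z \<in> Omega"
proof -
  interpret group PSL2Z by (rule group_PSL2Z)
  from assms(2) obtain D where "D \<in> carrier PSL2Z" "z = psl_act D (cis (pi / 3))"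
    by (auto simp: Omega_def orbit_def)
  with assms(1) have "C \<otimes>\<^bsub>PSL2Z\<^esub> D \<in> carrier PSL2Z"
      "psl_act C z = psl_act (C \<otimes>\<^bsub>PSL2Z\<^esub> D) (cis (pi / 3))"
    by (simp_all add: psl_act_mult cis_third_in_UHP)
  then show ?thesis unfolding Omega_def orbit_def by blast
qed

lemma psl_act_inv:
  assumes "C \<in> carrier PSL2Z" "z \<in> UHP"
  shows "psl_act (inv\<^bsub>PSL2Z\<^esub> C) (psl_act C z) = z" "psl_act C (psl_act (inv\<^bsub>PSL2Z\<^esub> C) z) = z"
proof -
  interpret group PSL2Z by (rule group_PSL2Z)
  show "psl_act (inv\<^bsub>PSL2Z\<^esub> C) (psl_act C z) = z" "psl_act C (psl_act (inv\<^bsub>PSL2Z\<^esub> C) z) = z"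
    using assms by (simp_all add: psl_act_one flip: psl_act_mult)
qed

lemma base_edge_subset_UHP: "base_edge \<subseteq> UHP"
proof -
  have "0 < sin t" if "pi / 3 \<le> t" "t \<le> 2 * pi / 3" for t
    using that pi_gt_zero by (intro sin_gt_zero) linarith+
  then show ?thesis by (auto simp: base_edge_def UHP_def)
qed

lemma base_edge_Omega: "base_edge \<inter> Omega = {cis (pi / 3), cis (2 * pi / 3)}"
proof
  have "cis (2 * pi / 3) = Complex (- 1 / 2) (sqrt 3 / 2)"
    by (simp add: complex_eq_iff cos_120 sin_120)
  moreover have "cis (pi / 3) = Complex (1 / 2) (sqrt 3 / 2)"
    by (simp add: complex_eq_iff cos_60 sin_60)
  moreover define A :: "int ^ 2 ^ 2" where "A = vector [vector [1, - 1], vector [0, 1]]"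
  moreover have "det A = 1" by (simp add: A_def det_2)
  ultimately have "cis (2 * pi / 3) = psl_act {A, - A} (cis (pi / 3))" "{A, - A} \<in> carrier PSL2Z"
    using cis_third_in_UHP by (auto simp: psl_act_coset moebius_map_def carrier_PSL2Z complex_eq_iff)
  then have "cis (2 * pi / 3) \<in> Omega" unfolding Omega_def orbit_def by blast
  moreover have "cis (pi / 3) \<in> Omega"
    unfolding Omega_def by (rule group_action.orbit_refl[OF group_action_PSL2Z cis_third_in_UHP])
  ultimately show "{cis (pi / 3), cis (2 * pi / 3)} \<subseteq> base_edge \<inter> Omega"
    by (auto simp: base_edge_def)
next
  show "base_edge \<inter> Omega \<subseteq> {cis (pi / 3), cis (2 * pi / 3)}"
  proof
    fix z assume z: "z \<in> base_edge \<inter> Omega"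
    then obtain t where t: "pi / 3 \<le> t" "t \<le> 2 * pi / 3" "z = cis t" by (auto simp: base_edge_def)
    from z obtain A where A: "det A = 1" "z = moebius_map A (cis (pi / 3))"
      using cis_third_in_UHP by (auto simp: Omega_def orbit_def carrier_PSL2Z psl_act_coset)
    define c d where "c = A $ 2 $ 1" and "d = A $ 2 $ 2"
    define N where "N = c\<^sup>2 + c * d + d\<^sup>2"
    have "(cmod (of_int c * cis (pi / 3) + of_int d))\<^sup>2 =
            (of_int c / 2 + of_int d)\<^sup>2 + (of_int c * sqrt 3 / 2)\<^sup>2"
      by (simp add: cmod_power2 cos_60 sin_60)
    also have "\<dots> = of_int N"
      by (simp add: N_def power2_eq_square field_simps)
    finally have N: "(cmod (of_int c * cis (pi / 3) + of_int d))\<^sup>2 = of_int N" .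
    have im: "sin t = (sqrt 3 / 2) / of_int N"
      using Im_moebius[OF A(1), of "cis (pi / 3)"] N
      by (simp add: c_def d_def sin_60 flip: A(2)) (simp add: t(3))
    have Npos: "N > 0"
      using moebius_denom_nz[OF A(1) cis_third_in_UHP] N
      by (metis c_def d_def norm_eq_zero of_int_0_less_iff zero_less_power2)
    have half: "cos t \<le> 1 / 2" "cos t \<ge> - 1 / 2"
      using t cos_monotone_0_pi_le[of "pi / 3" t] cos_monotone_0_pi_le[of t "2 * pi / 3"] pi_gt_zero
      by (simp_all add: cos_60 cos_120)
    then have "\<bar>cos t\<bar> \<le> \<bar>1 / 2\<bar>" by linarith
    then have "(cos t)\<^sup>2 \<le> (1 / 2)\<^sup>2" by (simp only: abs_le_square_iff)
    then have "(cos t)\<^sup>2 \<le> 1 / 4" by (simp add: power2_eq_square)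
    then have s2: "(sin t)\<^sup>2 \<ge> 3 / 4" using sin_squared_eq[of t] by simp
    have sq: "(sin t)\<^sup>2 = (3 / 4) / (of_int N)\<^sup>2" unfolding im by (simp add: power_divide)
    have "3 / 4 \<le> (3 / 4) / (of_int N :: real)\<^sup>2" using s2 unfolding sq .
    moreover have "(of_int N :: real)\<^sup>2 > 0" using Npos by simp
    ultimately have "(of_int N :: real)\<^sup>2 \<le> 1" by (simp add: pos_le_divide_eq)
    then have "N = 1" using Npos by (simp add: abs_square_le_1)
    then have "(cos t)\<^sup>2 = (1 / 2)\<^sup>2" using sq cos_squared_eq[of t] by (simp add: power_divide)
    then have "cos t = 1 / 2 \<or> cos t = - (1 / 2)" by (simp only: power2_eq_iff)
    then show "z \<in> {cis (pi / 3), cis (2 * pi / 3)}"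
      using im \<open>N = 1\<close> t(3) by (auto simp: complex_eq_iff cos_60 sin_60 cos_120 sin_120)
  qed
qed

lemma edge_ends_translate:
  assumes C: "C \<in> carrier PSL2Z"
  shows "edge_ends (psl_act C ` base_edge) = {psl_act C (cis (pi / 3)), psl_act C (cis (2 * pi / 3))}"
proof -
  have "z \<in> Omega" if z: "z \<in> base_edge" "psl_act C z \<in> Omega" for z
  proof -
    interpret group PSL2Z by (rule group_PSL2Z)
    have "psl_act (inv\<^bsub>PSL2Z\<^esub> C) (psl_act C z) \<in> Omega" using z C by (simp add: psl_act_Omega)
    moreover have "z \<in> UHP" using z(1) base_edge_subset_UHP by blast
    ultimately show "z \<in> Omega" using C by (simp add: psl_act_inv)
  qed
  then have "psl_act C ` base_edge \<inter> Omega = psl_act C ` (base_edge \<inter> Omega)"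
    using C psl_act_Omega by blast
  then show ?thesis by (simp add: edge_ends_def base_edge_Omega)
qed

lemma halfplanes_subset_UHP: "K \<in> halfplanes \<Longrightarrow> K \<subseteq> UHP"
  using psl_act_closed by (auto simp: halfplanes_def base_halfplanes_def)

lemma halfplanes_translate:
  assumes "C \<in> carrier PSL2Z" "K \<in> halfplanes"
  shows "psl_act C ` K \<in> halfplanes"
proof -
  interpret group PSL2Z by (rule group_PSL2Z)
  from assms(2) obtain D L where D: "D \<in> carrier PSL2Z" "L \<in> base_halfplanes" "K = psl_act D ` L"
    by (auto simp: halfplanes_def)
  then have "L \<subseteq> UHP" by (auto simp: base_halfplanes_def)
  then have "psl_act C ` K = psl_act (C \<otimes>\<^bsub>PSL2Z\<^esub> D) ` L"
    unfolding D(3) image_image using assms(1) D(1) by (intro image_cong) (auto simp: psl_act_mult)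
  moreover have "C \<otimes>\<^bsub>PSL2Z\<^esub> D \<in> carrier PSL2Z" using assms(1) D(1) by simp
  ultimately show ?thesis using D(2) unfolding halfplanes_def by blast
qed

lemma polyhedral_piece_translate:
  assumes C: "C \<in> carrier PSL2Z" and S: "polyhedral_piece S"
  shows "polyhedral_piece (psl_act C ` S)"
proof -
  interpret group PSL2Z by (rule group_PSL2Z)
  from S obtain F where F: "finite F" "F \<subseteq> halfplanes" "S = Omega \<inter> (UHP \<inter> \<Inter>F)"
    by (auto simp: polyhedral_piece_def convex_polyhedral_def)
  define F' where "F' = (`) (psl_act C) ` F"
  have "psl_act C ` S = Omega \<inter> (UHP \<inter> \<Inter>F')"
  proof (intro equalityI subsetI)
    fix w assume "w \<in> psl_act C ` S"
    then show "w \<in> Omega \<inter> (UHP \<inter> \<Inter>F')"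
      using C psl_act_Omega psl_act_closed unfolding F(3) F'_def by blast
  next
    fix w assume w: "w \<in> Omega \<inter> (UHP \<inter> \<Inter>F')"
    define z where "z = psl_act (inv\<^bsub>PSL2Z\<^esub> C) w"
    have z: "z \<in> Omega" "z \<in> UHP" and wz: "w = psl_act C z"
      using w C psl_act_Omega psl_act_closed by (auto simp: z_def psl_act_inv)
    have "z \<in> K" if "K \<in> F" for K
    proof -
      from w that obtain k where "k \<in> K" "w = psl_act C k" by (auto simp: F'_def)
      then show ?thesis
        using halfplanes_subset_UHP[of K] that F(2) C by (auto simp: z_def psl_act_inv subset_iff)
    qed
    with z wz show "w \<in> psl_act C ` S" unfolding F(3) by blast
  qed
  moreover have "finite F'" "F' \<subseteq> halfplanes"
    using F C halfplanes_translate by (auto simp: F'_def)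
  ultimately show ?thesis unfolding polyhedral_piece_def convex_polyhedral_def by blast
qed

lemma polyhedral_piece_Int:
  assumes "polyhedral_piece S" "polyhedral_piece S'"
  shows "polyhedral_piece (S \<inter> S')"
proof -
  from assms obtain F F' where "finite F" "F \<subseteq> halfplanes" "S = Omega \<inter> (UHP \<inter> \<Inter>F)"
      "finite F'" "F' \<subseteq> halfplanes" "S' = Omega \<inter> (UHP \<inter> \<Inter>F')"
    by (auto simp: polyhedral_piece_def convex_polyhedral_def)
  then have "finite (F \<union> F')" "F \<union> F' \<subseteq> halfplanes" "S \<inter> S' = Omega \<inter> (UHP \<inter> \<Inter>(F \<union> F'))"
    by auto
  then show ?thesis
    unfolding polyhedral_piece_def convex_polyhedral_def
    by (intro exI[of _ "UHP \<inter> \<Inter>(F \<union> F')"] exI[of _ "F \<union> F'"] conjI refl)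
qed

lemma polyhedral_piece_Omega: "polyhedral_piece Omega"
  unfolding polyhedral_piece_def convex_polyhedral_def
  using Omega_subset_UHP by (intro exI[of _ UHP] conjI exI[of _ "{}"]) auto

lemma piecewise_isometricE:
  assumes "piecewise_isometric g"
  obtains \<S> c where "finite \<S>" "\<Union>\<S> = Omega"
    "\<And>S. S \<in> \<S> \<Longrightarrow> polyhedral_piece S" "\<And>S. S \<in> \<S> \<Longrightarrow> c S \<in> carrier PSL2Z"
    "\<And>S z. S \<in> \<S> \<Longrightarrow> z \<in> S \<Longrightarrow> g z = psl_act (c S) z"
proof -
  from assms obtain \<S> where S: "finite \<S>" "\<Union>\<S> = Omega"
    "\<forall>S\<in>\<S>. polyhedral_piece S \<and> (\<exists>C\<in>carrier PSL2Z. \<forall>z\<in>S. g z = psl_act C z)"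
    unfolding piecewise_isometric_def by blast
  then have "\<forall>S\<in>\<S>. \<exists>C. C \<in> carrier PSL2Z \<and> (\<forall>z\<in>S. g z = psl_act C z)" by blast
  then obtain c where "\<forall>S\<in>\<S>. c S \<in> carrier PSL2Z \<and> (\<forall>z\<in>S. g z = psl_act (c S) z)"
    by (rule bchoice[THEN exE])
  with S show thesis by (intro that[of \<S> c]) simp_all
qed

lemma piecewise_isometric_compose:
  assumes "piecewise_isometric f" "piecewise_isometric g" "g \<in> Bij Omega"
  shows "piecewise_isometric (compose Omega f g)"
proof -
  interpret group PSL2Z by (rule group_PSL2Z)
  from assms(1) obtain \<T> d where T: "finite \<T>" "\<Union>\<T> = Omega"
    "\<And>S. S \<in> \<T> \<Longrightarrow> polyhedral_piece S" "\<And>S. S \<in> \<T> \<Longrightarrow> d S \<in> carrier PSL2Z"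
    "\<And>S z. S \<in> \<T> \<Longrightarrow> z \<in> S \<Longrightarrow> f z = psl_act (d S) z"
    by (rule piecewise_isometricE) blast
  from assms(2) obtain \<S> c where S: "finite \<S>" "\<Union>\<S> = Omega"
    "\<And>S. S \<in> \<S> \<Longrightarrow> polyhedral_piece S" "\<And>S. S \<in> \<S> \<Longrightarrow> c S \<in> carrier PSL2Z"
    "\<And>S z. S \<in> \<S> \<Longrightarrow> z \<in> S \<Longrightarrow> g z = psl_act (c S) z"
    by (rule piecewise_isometricE) blast
  define P where "P = (\<lambda>(S, T). S \<inter> psl_act (inv\<^bsub>PSL2Z\<^esub> (c S)) ` T)"
  have P: "P (S, T) = {z \<in> S. g z \<in> T}" if "S \<in> \<S>" "T \<in> \<T>" for S T
  proof -
    have "T \<subseteq> UHP" "S \<subseteq> UHP" using S(2) T(2) Omega_subset_UHP that by blast+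
    have c: "c S \<in> carrier PSL2Z" by (rule S(4)[OF that(1)])
    show ?thesis
    proof (intro equalityI subsetI)
      fix z assume "z \<in> P (S, T)"
      then obtain t where t: "z \<in> S" "t \<in> T" "z = psl_act (inv\<^bsub>PSL2Z\<^esub> (c S)) t"
        by (auto simp: P_def)
      then have "t \<in> UHP" using \<open>T \<subseteq> UHP\<close> by blast
      have "g z = psl_act (c S) z" by (rule S(5)[OF that(1) t(1)])
      also have "\<dots> = t" unfolding t(3) by (rule psl_act_inv(2)[OF c \<open>t \<in> UHP\<close>])
      finally show "z \<in> {z \<in> S. g z \<in> T}" using t by simp
    next
      fix z assume z: "z \<in> {z \<in> S. g z \<in> T}"
      then have "z \<in> UHP" using \<open>S \<subseteq> UHP\<close> by blast
      have "g z = psl_act (c S) z" using S(5)[OF that(1)] z by simp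
      then have "z = psl_act (inv\<^bsub>PSL2Z\<^esub> (c S)) (g z)"
        using psl_act_inv(1)[OF c \<open>z \<in> UHP\<close>] by simp
      then show "z \<in> P (S, T)" using z by (auto simp: P_def)
    qed
  qed
  show ?thesis
    unfolding piecewise_isometric_def
  proof (intro exI[of _ "P ` (\<S> \<times> \<T>)"] conjI ballI)
    show "finite (P ` (\<S> \<times> \<T>))" using S(1) T(1) by simp
    have g: "g z \<in> Omega" if "z \<in> Omega" for z using Bij_imp_funcset[OF assms(3)] that by blast
    show "\<Union>(P ` (\<S> \<times> \<T>)) = Omega"
    proof (intro equalityI subsetI)
      fix z assume z: "z \<in> Omega"
      then obtain S' where "S' \<in> \<S>" "z \<in> S'" using S(2) by blast
      moreover obtain T' where "T' \<in> \<T>" "g z \<in> T'" using T(2) g[OF z] by blast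
      ultimately show "z \<in> \<Union>(P ` (\<S> \<times> \<T>))"
        using P by (intro UN_I[of "(S', T')"]) auto
    qed (use S(2) in \<open>auto simp: P_def\<close>)
  next
    fix R assume "R \<in> P ` (\<S> \<times> \<T>)"
    then obtain S' T' where R: "S' \<in> \<S>" "T' \<in> \<T>" "R = P (S', T')" by auto
    show "polyhedral_piece R"
      unfolding R(3) P_def using R S(3,4) T(3)
      by (auto intro!: polyhedral_piece_Int polyhedral_piece_translate)
    have "compose Omega f g z = psl_act (d T' \<otimes>\<^bsub>PSL2Z\<^esub> c S') z" if "z \<in> R" for z
    proof -
      have "z \<in> S'" "g z \<in> T'" using that P[OF R(1,2)] R(3) by auto
      moreover from \<open>z \<in> S'\<close> R(1) S(2) have "z \<in> Omega" by blast
      moreover from this have "z \<in> UHP" using Omega_subset_UHP by blast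
      moreover have "g z = psl_act (c S') z" by (rule S(5)[OF R(1) \<open>z \<in> S'\<close>])
      moreover have "f (g z) = psl_act (d T') (g z)" by (rule T(5)[OF R(2) \<open>g z \<in> T'\<close>])
      ultimately show ?thesis
        using S(4)[OF R(1)] T(4)[OF R(2)] by (simp add: compose_def psl_act_mult)
    qed
    then show "\<exists>C\<in>carrier PSL2Z. \<forall>z\<in>R. compose Omega f g z = psl_act C z"
      using R S(4) T(4) by (intro bexI[of _ "d T' \<otimes>\<^bsub>PSL2Z\<^esub> c S'"]) auto
  qed
qed

lemma piecewise_isometric_inv:
  assumes "piecewise_isometric g" "g \<in> Bij Omega"
  shows "piecewise_isometric (\<lambda>z\<in>Omega. inv_into Omega g z)"
proof -
  interpret group PSL2Z by (rule group_PSL2Z)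
  from assms(1) obtain \<S> c where S: "finite \<S>" "\<Union>\<S> = Omega"
    "\<And>S. S \<in> \<S> \<Longrightarrow> polyhedral_piece S" "\<And>S. S \<in> \<S> \<Longrightarrow> c S \<in> carrier PSL2Z"
    "\<And>S z. S \<in> \<S> \<Longrightarrow> z \<in> S \<Longrightarrow> g z = psl_act (c S) z"
    by (rule piecewise_isometricE) blast
  have g: "inj_on g Omega" "g ` Omega = Omega" using assms(2) by (auto simp: Bij_def bij_betw_def)
  have eq: "psl_act (c S) ` S = g ` S" if "S \<in> \<S>" for S using S(5)[OF that] by force
  show ?thesis
    unfolding piecewise_isometric_def
  proof (intro exI[of _ "(\<lambda>S. psl_act (c S) ` S) ` \<S>"] conjI ballI)
    show "finite ((\<lambda>S. psl_act (c S) ` S) ` \<S>)" using S(1) by simp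
    have "\<Union>((\<lambda>S. psl_act (c S) ` S) ` \<S>) = g ` \<Union>\<S>" using eq by auto
    then show "\<Union>((\<lambda>S. psl_act (c S) ` S) ` \<S>) = Omega" using S(2) g(2) by simp
  next
    fix R assume "R \<in> (\<lambda>S. psl_act (c S) ` S) ` \<S>"
    then obtain S' where R: "S' \<in> \<S>" "R = psl_act (c S') ` S'" by auto
    show "polyhedral_piece R" using R S(3,4) polyhedral_piece_translate by blast
    have "inv_into Omega g w = psl_act (inv\<^bsub>PSL2Z\<^esub> (c S')) w \<and> w \<in> Omega" if "w \<in> R" for w
    proof -
      from that R obtain z where z: "z \<in> S'" "w = psl_act (c S') z" by auto
      with R(1) S(2) have "z \<in> Omega" by blast
      have "w = g z" using z S(5)[OF R(1)] by simp
      then have "inv_into Omega g w = z" "w \<in> Omega" using g \<open>z \<in> Omega\<close> by auto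
      moreover have "psl_act (inv\<^bsub>PSL2Z\<^esub> (c S')) w = z"
        using psl_act_inv(1)[OF S(4)[OF R(1)]] \<open>z \<in> Omega\<close> Omega_subset_UHP z(2) by blast
      ultimately show ?thesis by simp
    qed
    then show "\<exists>C\<in>carrier PSL2Z. \<forall>z\<in>R. (\<lambda>z\<in>Omega. inv_into Omega g z) z = psl_act C z"
      using R S(4) by (intro bexI[of _ "inv\<^bsub>PSL2Z\<^esub> (c S')"]) auto
  qed
qed

lemma piecewise_isometric_id: "piecewise_isometric (\<lambda>z\<in>Omega. z)"
proof -
  interpret group PSL2Z by (rule group_PSL2Z)
  show ?thesis
    unfolding piecewise_isometric_def
    using polyhedral_piece_Omega psl_act_one Omega_subset_UHP
    by (intro exI[of _ "{Omega}"]) (auto intro!: bexI[of _ "\<one>\<^bsub>PSL2Z\<^esub>"])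
qed

lemma subgroup_phi: "subgroup (carrier phi) (BijGroup Omega)"
proof (rule group.subgroupI[OF group_BijGroup])
  show "carrier phi \<noteq> {}"
    using piecewise_isometric_id id_Bij by (auto simp: phi_def BijGroup_def)
next
  fix f assume "f \<in> carrier phi"
  then have f: "f \<in> Bij Omega" "piecewise_isometric f" by (auto simp: phi_def BijGroup_def)
  show "inv\<^bsub>BijGroup Omega\<^esub> f \<in> carrier phi"
    unfolding inv_BijGroup[OF f(1)]
    using piecewise_isometric_inv[OF f(2,1)] restrict_inv_into_Bij[OF f(1)]
    by (simp only: phi_def BijGroup_def partial_object.simps mem_Collect_eq simp_thms)
next
  fix f g assume "f \<in> carrier phi" "g \<in> carrier phi"
  then show "f \<otimes>\<^bsub>BijGroup Omega\<^esub> g \<in> carrier phi"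
    by (simp add: phi_def BijGroup_def compose_Bij piecewise_isometric_compose)
qed (auto simp: phi_def)

lemma group_phi: "group phi"
  using subgroup.subgroup_is_group[OF subgroup_phi group_BijGroup] by (simp add: phi_def)

end

theory Submission
  imports Defs
begin

text \<open>
  A half-plane pulled back by a matrix is the positivity set of an indefinite binary quadratic form
  of fixed discriminant. If it separates the endpoints of the base edge then the form takes opposite
  signs at two given points, which bounds the entries of the matrix. So every polyhedral piece
  separates only finitely many edges, and away from these a piecewise isometric permutation agrees
  with a group element on the whole star of a vertex.

  Conversely, the half-tree beyond an oriented edge, together with the origin of that edge, is a
  polyhedral piece. If all links in it are respected, the permutation is determined there by its
  values on the edge, hence agrees with a group element. Every half-tree is a vertex and two smaller
  half-trees, and the height of all vertices grows by at least 1 in this step, so after finitely many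
  steps the half-trees avoid the finitely many vertices whose links are not respected.
\<close>

section \<open>The generators of the modular group\<close>

definition mob :: "int \<Rightarrow> int \<Rightarrow> int \<Rightarrow> int \<Rightarrow> (int ^ 2 ^ 2) set" where
  "mob a b c d = (let A = vector [vector [a, b], vector [c, d]] in {A, - A})"

lemma mob_carrier: "a * d - b * c = 1 \<Longrightarrow> mob a b c d \<in> carrier PSL2Z"
  unfolding mob_def Let_def carrier_PSL2Z by (auto simp: det_2)

lemma psl_act_mob:
  "z \<in> UHP \<Longrightarrow> psl_act (mob a b c d) z = (of_int a * z + of_int b) / (of_int c * z + of_int d)"
  by (simp add: mob_def Let_def psl_act_coset moebius_map_def)

lemma PSL2Z_cases:
  assumes "C \<in> carrier PSL2Z"
  obtains a b c d where "a * d - b * c = 1" "C = mob a b c d"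
proof -
  from assms obtain A where A: "det A = 1" "C = {A, - A}" by (auto simp: carrier_PSL2Z)
  have "A = vector [vector [A$1$1, A$1$2], vector [A$2$1, A$2$2]]"
    by (simp add: mat2_eq_iff)
  with A show thesis by (intro that[of "A$1$1" "A$2$2" "A$1$2" "A$2$1"]) (simp_all add: det_2 mob_def)
qed

text \<open>
  Oriented edges of the tree correspond to elements \<open>C\<close> of the group: \<open>C\<close> stands for the edge from
  \<open>C zeta\<close> to \<open>C omega\<close>.
\<close>

definition zeta :: complex where "zeta = cis (pi / 3)"
definition omega :: complex where "omega = cis (2 * pi / 3)"

lemma zeta_eq: "zeta = Complex (1 / 2) (sqrt 3 / 2)"
  by (simp add: zeta_def complex_eq_iff cos_60 sin_60)

lemma omega_eq: "omega = Complex (- 1 / 2) (sqrt 3 / 2)"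
  by (simp add: omega_def complex_eq_iff cos_120 sin_120)

text \<open>
  \<open>rot\<close> is the counterclockwise rotation by a third of a turn about \<open>zeta\<close>, \<open>flip\<close> reverses the base
  edge, and \<open>left\<close>, \<open>right\<close> move it one step beyond \<open>omega\<close>.
\<close>

definition rot :: "(int ^ 2 ^ 2) set" where "rot = mob 0 1 (- 1) 1"
definition flip :: "(int ^ 2 ^ 2) set" where "flip = mob 0 (- 1) 1 0"
definition left :: "(int ^ 2 ^ 2) set" where "left = mob 1 (- 1) 0 1"
definition right :: "(int ^ 2 ^ 2) set" where "right = mob 1 0 (- 1) 1"

lemma generators_carrier [simp]:
  "rot \<in> carrier PSL2Z" "flip \<in> carrier PSL2Z" "left \<in> carrier PSL2Z" "right \<in> carrier PSL2Z"
  by (simp_all add: rot_def flip_def left_def right_def mob_carrier)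

lemma generators_act:
  assumes "z \<in> UHP"
  shows "psl_act rot z = 1 / (1 - z)" "psl_act flip z = - 1 / z"
    "psl_act left z = z - 1" "psl_act right z = z / (1 - z)"
  using assms by (simp_all add: rot_def flip_def left_def right_def psl_act_mob)

lemma Omega_UHP: "z \<in> Omega \<Longrightarrow> z \<in> UHP"
  using Omega_subset_UHP by blast

lemma zeta_Omega [simp]: "zeta \<in> Omega" and omega_Omega [simp]: "omega \<in> Omega"
  using base_edge_Omega by (auto simp: zeta_def omega_def)

lemma zeta_UHP [simp]: "zeta \<in> UHP" and omega_UHP [simp]: "omega \<in> UHP"
  by (simp_all add: Omega_UHP)

lemma Omega_cases:
  assumes "z \<in> Omega"
  obtains C where "C \<in> carrier PSL2Z" "z = psl_act C zeta"
  using assms by (auto simp: Omega_def orbit_def zeta_def)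

lemma UHP_nz_simps: "z \<in> UHP \<Longrightarrow> z \<noteq> 0" "z \<in> UHP \<Longrightarrow> 1 - z \<noteq> 0" "z \<in> UHP \<Longrightarrow> 1 + z \<noteq> 0"
  by (auto simp: UHP_def complex_eq_iff)

text \<open>The vertices \<open>omega\<close>, \<open>rot omega\<close>,
  \<open>rot (rot omega)\<close> are the neighbours of \<open>zeta\<close>. By the last two
  equations \<open>flip\<close> carries them to \<open>zeta\<close>, \<open>left omega\<close>,
  \<open>right omega\<close>, so facts about the link of \<open>zeta\<close> transfer to the link of
  \<open>omega\<close>.\<close>

lemma generator_values:
  "psl_act rot zeta = zeta" "psl_act flip zeta = omega" "psl_act flip omega = zeta"
  "psl_act left zeta = omega" "psl_act right zeta = omega"
  "psl_act rot omega = Complex (1/2) (sqrt 3 / 6)"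
  "psl_act rot (psl_act rot omega) = Complex (3/2) (sqrt 3 / 2)"
  "psl_act flip (psl_act rot omega) = psl_act left omega"
  "psl_act flip (psl_act rot (psl_act rot omega)) = psl_act right omega"
proof -
  have 1: "psl_act rot omega = Complex (1/2) (sqrt 3 / 6)"
    unfolding generators_act(1)[OF omega_UHP]
    by (simp add: omega_eq complex_eq_iff Re_divide Im_divide power2_eq_square)
  have U: "Complex (1/2) (sqrt 3 / 6) \<in> UHP" "Complex (3/2) (sqrt 3 / 2) \<in> UHP" by (simp_all add: UHP_def)
  show 2: "psl_act rot (psl_act rot omega) = Complex (3/2) (sqrt 3 / 2)"
    unfolding 1 generators_act(1)[OF U(1)]
    by (simp add: complex_eq_iff Re_divide Im_divide power2_eq_square field_simps)
  show "psl_act flip (psl_act rot omega) = psl_act left omega"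
    unfolding 1 generators_act(2)[OF U(1)] generators_act(3)[OF omega_UHP] by (simp add: omega_eq complex_eq_iff Re_divide Im_divide power2_eq_square field_simps)
  show "psl_act flip (psl_act rot (psl_act rot omega)) = psl_act right omega"
    unfolding 2 generators_act(2)[OF U(2)] generators_act(4)[OF omega_UHP] by (simp add: omega_eq complex_eq_iff Re_divide Im_divide power2_eq_square field_simps)
  show "psl_act rot omega = Complex (1/2) (sqrt 3 / 6)" by (rule 1)
  have z: "1 - zeta \<noteq> 0" "zeta \<noteq> 0" "omega \<noteq> 0" by (auto simp: complex_eq_iff zeta_eq omega_eq)
  show "psl_act rot zeta = zeta" "psl_act flip zeta = omega" "psl_act flip omega = zeta"
   "psl_act left zeta = omega" "psl_act right zeta = omega"
    by (simp_all only: generators_act zeta_UHP omega_UHP)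
      (simp_all add: zeta_eq omega_eq complex_eq_iff Re_divide Im_divide power2_eq_square)
qed

section \<open>Stabilizers of a vertex and of an oriented edge\<close>

lemma rot_rot:
  assumes "z \<in> UHP"
  shows "psl_act rot (psl_act rot z) = (z - 1) / z"
proof -
  have n: "z \<noteq> 0" "1 - z \<noteq> 0" using assms UHP_nz_simps by blast+
  have "1 - 1 / (1 - z) = - z / (1 - z)" using n by (simp add: diff_divide_eq_iff)
  then have "psl_act rot (psl_act rot z) = 1 / (- z / (1 - z))"
    using generators_act(1)[OF psl_act_closed[OF generators_carrier(1) assms]]
    by (simp only: generators_act(1)[OF assms])
  also have "\<dots> = (z - 1) / z" using minus_divide_divide[of "z - 1" z] by simp
  finally show ?thesis .
qed

lemma rot_cube:
  assumes "z \<in> UHP"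
  shows "psl_act rot (psl_act rot (psl_act rot z)) = z"
proof -
  have n: "z \<noteq> 0" "1 - z \<noteq> 0" using assms UHP_nz_simps by blast+
  have "(1 / (1 - z) - 1) / (1 / (1 - z)) = 1 - (1 - z)" using n by (simp add: left_diff_distrib)
  then show ?thesis
    using rot_rot[OF psl_act_closed[OF generators_carrier(1) assms]] unfolding generators_act(1)[OF assms] by simp
qed

text \<open>Fixing \<open>zeta\<close> determines the upper row of the matrix from the lower one,
  and the determinant becomes the form \<open>c^2 + c d + d^2\<close>. This form takes the value 1
  at six integer points, which give three transformations up to sign.\<close>

lemma stab_zeta:
  assumes "C \<in> carrier PSL2Z" "psl_act C zeta = zeta"
  obtains "\<forall>z\<in>UHP. psl_act C z = z"
   | "\<forall>z\<in>UHP. psl_act C z = psl_act rot z"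
   | "\<forall>z\<in>UHP. psl_act C z = psl_act rot (psl_act rot z)"
proof -
  from assms(1) obtain a b c d where C: "a * d - b * c = 1" "C = mob a b c d" by (rule PSL2Z_cases)
  have "of_int c * zeta + of_int d \<noteq> 0"
    using C(1) by (auto simp: complex_eq_iff zeta_eq)
  then have "of_int a * zeta + of_int b = zeta * (of_int c * zeta + of_int d)"
    using assms(2) unfolding C(2) by (simp add: psl_act_mob divide_eq_eq)
  then have "real_of_int a / 2 + of_int b = - of_int c / 2 + of_int d / 2"
    "sqrt 3 * real_of_int a = sqrt 3 * (of_int c + of_int d)"
    by (auto simp: zeta_eq complex_eq_iff field_simps)
  moreover from this(2) have "real_of_int a = of_int c + of_int d" by (simp only: mult_cancel_left) simp
  ultimately have a: "a = c + d" and b: "b = - c" by - linarith+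
  have q: "c * c + c * d + d * d = 1" using C(1) unfolding a b by (simp add: algebra_simps)
  \<comment> \<open>Completing the square in the definite form bounds each of \<open>c\<close> and
    \<open>d\<close>.\<close>
  have "3 * d^2 \<le> (2 * c + d)^2 + 3 * d^2" by simp
  also have "\<dots> = 4 * (c * c + c * d + d * d)" by (simp add: power2_eq_square algebra_simps)
  finally have d: "3 * d^2 \<le> 4" unfolding q by simp
  have "3 * c^2 \<le> (2 * d + c)^2 + 3 * c^2" by simp
  also have "\<dots> = 4 * (c * c + c * d + d * d)" by (simp add: power2_eq_square algebra_simps)
  finally have "3 * c^2 \<le> 4" unfolding q by simp
  with d have "d^2 \<le> 1" "c^2 \<le> 1" by simp_all
  then have "\<bar>c\<bar> \<le> 1" "\<bar>d\<bar> \<le> 1" by (simp_all add: abs_square_le_1)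
  then have "c \<in> {-1,0,1}" "d \<in> {-1,0,1}" by auto
  with q consider "c = 0 \<and> (d = 1 \<or> d = - 1)" | "c = - 1 \<and> d = 1 \<or> c = 1 \<and> d = - 1" | "d = 0 \<and> (c = 1 \<or> c = -1)"
    by auto
  then show thesis
  proof cases
    case 1
    then have "psl_act C z = z" if "z \<in> UHP" for z using that unfolding C(2) a b by (auto simp: psl_act_mob)
    then show thesis by (intro that(1) ballI)
  next
    case 2
    have "psl_act C z = psl_act rot z" if z: "z \<in> UHP" for z
    proof -
      from 2 have "C = mob 0 1 (- 1) 1 \<or> C = mob 0 (- 1) 1 (- 1)" unfolding C(2) a b by auto
      moreover have "(- 1) / (z - 1) = 1 / (1 - z)" using minus_divide_divide[of 1 "1 - z"] by simp
      ultimately show ?thesis using z by (auto simp: psl_act_mob generators_act)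
    qed
    then show thesis by (intro that(2) ballI)
  next
    case 3
    have "psl_act C z = psl_act rot (psl_act rot z)" if z: "z \<in> UHP" for z
    proof -
      from 3 have "C = mob 1 (- 1) 1 0 \<or> C = mob (- 1) 1 (- 1) 0" unfolding C(2) a b by auto
      moreover have "(1 - z) / - z = (z - 1) / z" using minus_divide_divide[of "z - 1" z] by simp
      ultimately show ?thesis using z by (auto simp: psl_act_mob rot_rot)
    qed
    then show thesis by (intro that(3) ballI)
  qed
qed

text \<open>Both nontrivial rotations about \<open>zeta\<close> move \<open>omega\<close>.\<close>

lemma edge_stabilizer:
  assumes "C \<in> carrier PSL2Z" "psl_act C zeta = zeta" "psl_act C omega = omega" "z \<in> UHP"
  shows "psl_act C z = z"
proof -
  have "psl_act rot omega \<noteq> omega" "psl_act rot (psl_act rot omega) \<noteq> omega"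
    unfolding generator_values(7) unfolding generator_values(6) by (simp_all add: omega_eq)
  note ne = this
  from stab_zeta[OF assms(1,2)] show ?thesis
  proof cases
    case 1
    then show ?thesis using assms(4) by blast
  next
    case 2
    then have "psl_act C omega = psl_act rot omega" using omega_UHP by blast
    then show ?thesis using ne assms(3) by simp
  next
    case 3
    then have "psl_act C omega = psl_act rot (psl_act rot omega)" using omega_UHP by blast
    then show ?thesis using ne assms(3) by simp
  qed
qed

lemma edge_determines_act:
  assumes "C \<in> carrier PSL2Z" "D \<in> carrier PSL2Z"
    "psl_act C zeta = psl_act D zeta" "psl_act C omega = psl_act D omega" "z \<in> UHP"
  shows "psl_act C z = psl_act D z"
proof -
  interpret group PSL2Z by (rule group_PSL2Z)
  have "psl_act (inv\<^bsub>PSL2Z\<^esub> D \<otimes>\<^bsub>PSL2Z\<^esub> C) z = z"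
    by (rule edge_stabilizer) (use assms in \<open>simp_all add: psl_act_mult psl_act_inv\<close>)
  then have "psl_act D (psl_act (inv\<^bsub>PSL2Z\<^esub> D) (psl_act C z)) = psl_act D z"
    using assms by (simp add: psl_act_mult)
  then show ?thesis using assms by (simp add: psl_act_inv psl_act_closed)
qed

section \<open>Branches of the tree\<close>

lemma UHP_iff: "z \<in> UHP \<longleftrightarrow> 0 < Im z"
  by (simp add: UHP_def)

text \<open>The imaginary part of \<open>C zeta\<close> is that of \<open>zeta\<close> divided by
  \<open>N\<close>, the value of \<open>c^2 + c d + d^2\<close> at the lower row; \<open>N\<close>
  is a positive integer.\<close>

lemma Im_Omega_le:
  assumes "z \<in> Omega"
  shows "Im z \<le> sqrt 3 / 2"
proof -
  from assms obtain C where "C \<in> carrier PSL2Z" "z = psl_act C zeta" by (rule Omega_cases)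
  then obtain A where A: "det A = 1" "z = moebius_map A zeta"
    by (auto simp: carrier_PSL2Z psl_act_coset)
  define N where "N = (A$2$1)^2 + A$2$1 * A$2$2 + (A$2$2)^2"
  have N: "(cmod (of_int (A$2$1) * zeta + of_int (A$2$2)))^2 = of_int N"
    unfolding N_def by (simp add: cmod_power2 zeta_eq) (simp add: power2_eq_square field_simps)
  have "0 < (cmod (of_int (A$2$1) * zeta + of_int (A$2$2)))^2"
    using moebius_denom_nz[OF A(1) zeta_UHP] by simp
  then have "1 \<le> N" unfolding N by simp
  then have "1 \<le> real_of_int N" by simp
  then have "Im zeta / of_int N \<le> Im zeta / 1" by (intro divide_left_mono) (simp_all add: zeta_eq)
  then show ?thesis using Im_moebius[OF A(1), of zeta] unfolding A(2) N by (simp add: zeta_eq)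
qed

lemma one_le_cmod_iff: "1 \<le> cmod z \<longleftrightarrow> 1 \<le> (Re z)\<^sup>2 + (Im z)\<^sup>2"
  and cmod_le_one_iff: "cmod z \<le> 1 \<longleftrightarrow> (Re z)\<^sup>2 + (Im z)\<^sup>2 \<le> 1"
  by (simp_all add: cmod_def)

lemma one_le_cmod_divide_iff:
  assumes "q \<noteq> 0"
  shows "1 \<le> cmod (p / q) \<longleftrightarrow> (Re q)\<^sup>2 + (Im q)\<^sup>2 \<le> (Re p)\<^sup>2 + (Im p)\<^sup>2"
  using assms by (simp add: norm_divide pos_le_divide_eq) (simp add: cmod_def)

lemma Re_divide_le_half_iff:
  assumes "q \<noteq> 0"
  shows "Re (p / q) \<le> 1 / 2 \<longleftrightarrow> 2 * (Re p * Re q + Im p * Im q) \<le> (Re q)\<^sup>2 + (Im q)\<^sup>2"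
proof -
  have "0 < (Re q)\<^sup>2 + (Im q)\<^sup>2" using assms by (simp add: complex_eq_iff sum_power2_gt_zero_iff)
  then show ?thesis by (simp add: Re_divide pos_divide_le_eq mult.commute)
qed

text \<open>With imaginary part at most \<open>sqrt 3 / 2\<close> and
  \<open>\<bar>Re z\<bar> \<le> 1 / 2\<close>, the modulus can reach 1 only if both bounds are
  attained.\<close>

lemma Omega_fundamental:
  assumes "z \<in> Omega" "1 \<le> cmod z" "\<bar>Re z\<bar> \<le> 1 / 2"
  shows "z = zeta \<or> z = omega"
proof -
  have y: "0 < Im z" "Im z \<le> sqrt 3 / 2" using assms(1) Im_Omega_le Omega_UHP UHP_iff by auto
  then have "(Im z)\<^sup>2 \<le> (sqrt 3 / 2)\<^sup>2" by (intro power_mono) auto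
  then have y2: "(Im z)\<^sup>2 \<le> 3 / 4" by (simp add: power_divide)
  have "\<bar>Re z\<bar>\<^sup>2 \<le> (1 / 2)\<^sup>2" using assms(3) by (intro power_mono) auto
  then have x2: "(Re z)\<^sup>2 \<le> 1 / 4" by (simp add: power_divide)
  have "1 \<le> (Re z)\<^sup>2 + (Im z)\<^sup>2" using assms(2) by (simp add: one_le_cmod_iff)
  with x2 y2 have "(Re z)\<^sup>2 = 1 / 4" "(Im z)\<^sup>2 = 3 / 4" by simp_all
  then have "(Re z)\<^sup>2 = (1 / 2)\<^sup>2" "(Im z)\<^sup>2 = (sqrt 3 / 2)\<^sup>2" by (simp_all add: power_divide)
  then have "Re z = 1 / 2 \<or> Re z = - (1 / 2)" "Im z = sqrt 3 / 2"
    using y by (simp_all only: power2_eq_iff) auto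
  then show ?thesis by (auto simp: complex_eq_iff zeta_eq omega_eq)
qed

text \<open>
  The sector of angle \<open>2 * pi / 3\<close> at \<open>zeta\<close> around the base edge cuts out \<open>zeta\<close> together with the
  half-tree beyond that edge. Up to an affine change, the height is the hyperbolic cosine of the
  distance from \<open>zeta\<close>.
\<close>

definition branch :: "complex set" where
  "branch = {z \<in> Omega. Re z \<le> 1 / 2 \<and> 1 \<le> cmod (z - 1)}"

definition height :: "complex \<Rightarrow> real" where
  "height z = (cmod (z - zeta))\<^sup>2 / Im z"

lemma branchD:
  assumes "z \<in> branch"
  shows "z \<in> Omega" "z \<in> UHP" "Re z \<le> 1 / 2" "2 * Re z \<le> (Re z)\<^sup>2 + (Im z)\<^sup>2"
  using assms by (auto simp: branch_def Omega_UHP one_le_cmod_iff power2_eq_square algebra_simps)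

lemma branchI:
  assumes "z \<in> Omega" "Re z \<le> 1 / 2" "2 * Re z \<le> (Re z)\<^sup>2 + (Im z)\<^sup>2"
  shows "z \<in> branch"
  using assms by (auto simp: branch_def Omega_UHP one_le_cmod_iff power2_eq_square algebra_simps)

lemma zeta_branch: "zeta \<in> branch"
  by (rule branchI) (simp_all add: zeta_eq[symmetric], simp_all add: zeta_eq power_divide)

lemma left_branch: assumes "z \<in> branch" shows "psl_act left z \<in> branch"
proof (rule branchI)
  show "psl_act left z \<in> Omega" using assms branchD(1) psl_act_Omega by simp
  show "Re (psl_act left z) \<le> 1 / 2" "2 * Re (psl_act left z) \<le> (Re (psl_act left z))\<^sup>2 + (Im (psl_act left z))\<^sup>2"
    using branchD[OF assms] by (auto simp: generators_act power2_eq_square algebra_simps)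
qed

lemma right_branch: assumes "z \<in> branch" shows "psl_act right z \<in> branch"
proof -
  note z = branchD[OF assms]
  have n: "1 - z \<noteq> 0" using z UHP_nz_simps by blast
  have "psl_act right z \<in> Omega" using z(1) psl_act_Omega by simp
  \<comment> \<open>This is the bound on the real part of \<open>z / (1 - z)\<close> with the
    denominator cleared; it is the sum of the two inequalities that define \<open>branch\<close>,
    weakened by a nonnegative term.\<close>
  have "4 * Re z \<le> 1 + (3 * (Re z)\<^sup>2 + 3 * (Im z)\<^sup>2)"
    using z(3,4) sum_power2_ge_zero[of "Re z" "Im z"] by linarith
  then have "Re (psl_act right z) \<le> 1 / 2"
    unfolding generators_act(4)[OF z(2)] Re_divide_le_half_iff[OF n]
    by (simp add: power2_eq_square algebra_simps)
  have rz: "psl_act right z - 1 = (2 * z - 1) / (1 - z)"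
    unfolding generators_act(4)[OF z(2)]
    by (subst eq_divide_eq) (use n in \<open>simp add: left_diff_distrib\<close>)
  have "2 * Re z \<le> 3 * (Re z)\<^sup>2 + 3 * (Im z)\<^sup>2"
    using z(3,4) sum_power2_ge_zero[of "Re z" "Im z"] by linarith
  then have "1 \<le> cmod (psl_act right z - 1)"
    unfolding rz one_le_cmod_divide_iff[OF n] by (simp add: power2_eq_square algebra_simps)
  with \<open>psl_act right z \<in> Omega\<close> \<open>Re (psl_act right z) \<le> 1 / 2\<close>
  show ?thesis by (simp add: branch_def)
qed

section \<open>Growth of the height and decomposition of a half-tree\<close>

lemma height_nonneg: "z \<in> UHP \<Longrightarrow> 0 \<le> height z"
  by (simp add: height_def UHP_iff)

text \<open>The translation keeps the imaginary part and increases the squared distance to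
  \<open>zeta\<close> by \<open>2 - 2 * Re z\<close>, which is at least 1 and hence at least
  \<open>Im z\<close>.\<close>

lemma height_left: assumes "z \<in> branch" shows "height z + 1 \<le> height (psl_act left z)"
proof -
  note z = branchD[OF assms]
  have y: "0 < Im z" "Im z \<le> sqrt 3 / 2" using z Im_Omega_le UHP_iff by auto
  have "sqrt 3 / 2 \<le> 1" using real_sqrt_le_mono[of 3 4] by simp
  then have "(cmod (z - zeta))\<^sup>2 + Im z \<le> (cmod (psl_act left z - zeta))\<^sup>2"
    using y z(3) unfolding generators_act(3)[OF z(2)]
    by (simp add: cmod_power2 zeta_eq) (simp add: power2_eq_square algebra_simps)
  then have "((cmod (z - zeta))\<^sup>2 + Im z) / Im z \<le> (cmod (psl_act left z - zeta))\<^sup>2 / Im z"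
    using y by (intro divide_right_mono) auto
  then show ?thesis using y by (simp add: height_def add_divide_distrib generators_act z(2))
qed

text \<open>The factor \<open>(cmod (1 - z))\<^sup>2\<close> cancels in the height of
  \<open>z / (1 - z)\<close>, leaving \<open>(cmod (z - zeta + zeta * z))\<^sup>2 / Im z\<close>.
  The numerator exceeds the one for \<open>z\<close> by twice
  \<open>(cmod z)\<^sup>2 - Re z\<close>, which is at least \<open>(cmod z)\<^sup>2\<close> on the
  branch and so at least \<open>Im z\<close>.\<close>

lemma height_right: assumes "z \<in> branch" shows "height z + 1 \<le> height (psl_act right z)"
proof -
  note z = branchD[OF assms]
  have n: "1 - z \<noteq> 0" "z \<noteq> 0" using z UHP_nz_simps by blast+
  have y: "0 < Im z" using z UHP_iff by auto
  \<comment> \<open>The height bound for vertices, applied to \<open>- 1 / z\<close>, yields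
    \<open>Im z \<le> (cmod z)\<^sup>2\<close>.\<close>
  have "psl_act flip z \<in> Omega" using z(1) psl_act_Omega by simp
  then have "Im (psl_act flip z) \<le> sqrt 3 / 2" by (rule Im_Omega_le)
  moreover have "sqrt 3 / 2 \<le> 1" using real_sqrt_le_mono[of 3 4] by simp
  moreover have "Im (psl_act flip z) = Im z / (cmod z)\<^sup>2"
    by (simp add: generators_act z(2) Im_divide cmod_power2)
  ultimately have "Im z / (cmod z)\<^sup>2 \<le> 1" by linarith
  moreover have "0 < (cmod z)\<^sup>2" using n by simp
  ultimately have 1: "Im z \<le> (Re z)\<^sup>2 + (Im z)\<^sup>2" by (simp only: pos_divide_le_eq mult_1 cmod_power2)
  have zz: "psl_act right z - zeta = (z - zeta + zeta * z) / (1 - z)"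
    unfolding generators_act(4)[OF z(2)]
    by (subst eq_divide_eq) (use n in \<open>simp add: left_diff_distrib, simp add: algebra_simps\<close>)
  \<comment> \<open>The left side is the squared modulus of \<open>z - zeta + zeta * z\<close> in
    coordinates, with \<open>r\<close> for \<open>sqrt 3\<close>, so that only
    \<open>r * r = 3\<close> enters the computation.\<close>
  have "(3 * x / 2 + (- (1 / 2) - r * y / 2))\<^sup>2 + (3 * y / 2 + (r * x / 2 - r / 2))\<^sup>2 =
      (x - 1 / 2)\<^sup>2 + (y - r / 2)\<^sup>2 + 2 * (x\<^sup>2 + y\<^sup>2 - x)" if "r * r = 3" for r x y :: real
  proof -
    have r: "r * (r * t) = 3 * t" for t using that by (simp flip: mult.assoc)
    show ?thesis by (simp add: power2_eq_square field_simps r)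
  qed
  from this[of "sqrt 3" "Re z" "Im z"]
  have "(cmod (z - zeta + zeta * z))\<^sup>2 = (cmod (z - zeta))\<^sup>2 + (2 * (Re z)\<^sup>2 + 2 * (Im z)\<^sup>2 - 2 * Re z)"
    unfolding cmod_power2 zeta_eq by (simp add: algebra_simps)
  with z(4) 1 have 2: "(cmod (z - zeta))\<^sup>2 + Im z \<le> (cmod (z - zeta + zeta * z))\<^sup>2" by linarith
  have "Im (psl_act right z) = Im z / (cmod (1 - z))\<^sup>2"
    by (simp add: generators_act z(2) Im_divide cmod_power2 algebra_simps)
  then have "height (psl_act right z) = (cmod (z - zeta + zeta * z))\<^sup>2 / Im z"
    unfolding height_def zz using n by (simp add: norm_divide power_divide)
  moreover have "((cmod (z - zeta))\<^sup>2 + Im z) / Im z \<le> (cmod (z - zeta + zeta * z))\<^sup>2 / Im z"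
    using y 2 by (intro divide_right_mono) auto
  ultimately show ?thesis using y by (simp add: height_def add_divide_distrib)
qed

text \<open>The circles \<open>cmod z = 1\<close>, \<open>cmod (1 + z) = 1\<close> and the line
  \<open>Re z = - 1 / 2\<close> cut the sector into four regions. Two of them are the images under
  \<open>left\<close> and \<open>right\<close>. The other two lie in the fundamental polyhedron or
  in its image under \<open>flip\<close>, where the only vertex that can remain is
  \<open>zeta\<close>.\<close>

lemma branch_cases:
  assumes "z \<in> branch"
  obtains "z = zeta" | w where "w \<in> branch" "z = psl_act left w" | w where "w \<in> branch" "z = psl_act right w"
proof -
  note split = that
  note z = branchD[OF assms]
  have n: "1 + z \<noteq> 0" "z \<noteq> 0" using z UHP_nz_simps by blast+
  have y: "0 < Im z" using z UHP_iff by auto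
  have L: thesis if "1 \<le> cmod z" "Re z \<le> - 1 / 2"
  proof (rule split(2))
    \<comment> \<open>The matrix is the inverse of the one defining \<open>left\<close>.\<close>
    have e: "psl_act (mob 1 1 0 1) z = z + 1" by (simp add: psl_act_mob z(2))
    have "psl_act (mob 1 1 0 1) z \<in> Omega" by (rule psl_act_Omega) (simp_all add: mob_carrier z)
    then show "z + 1 \<in> branch" unfolding e using that by (simp add: branch_def)
    then show "z = psl_act left (z + 1)" by (simp add: generators_act branchD)
  qed
  have R: thesis if "cmod z \<le> 1" "cmod (1 + z) \<le> 1"
  proof (rule split(3))
    \<comment> \<open>The matrix is the inverse of the one defining \<open>right\<close>.\<close>
    have e: "psl_act (mob 1 0 1 1) z = z / (1 + z)" by (simp add: psl_act_mob z(2) add.commute)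
    have "psl_act (mob 1 0 1 1) z \<in> Omega" by (rule psl_act_Omega) (simp_all add: mob_carrier z)
    then have "z / (1 + z) \<in> Omega" unfolding e .
    moreover have "z / (1 + z) - 1 = - 1 / (1 + z)"
      by (subst eq_divide_eq) (use n in \<open>simp add: left_diff_distrib\<close>)
    then have "1 \<le> cmod (z / (1 + z) - 1)" using that(2) n by (simp add: norm_divide pos_le_divide_eq)
    moreover have "Re (z / (1 + z)) \<le> 1 / 2"
      unfolding Re_divide_le_half_iff[OF n(1)] using that(1)
      by (simp add: cmod_le_one_iff power2_eq_square algebra_simps)
    ultimately show "z / (1 + z) \<in> branch" by (simp add: branch_def)
    then have "psl_act right (z / (1 + z)) = (z / (1 + z)) / (1 - z / (1 + z))" by (simp add: generators_act branchD)
    also have "1 - z / (1 + z) = 1 / (1 + z)" using n by (simp add: diff_divide_eq_iff)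
    also have "z / (1 + z) / (1 / (1 + z)) = z" using n by simp
    finally show "z = psl_act right (z / (1 + z))" ..
  qed
  show thesis
  proof (cases "1 \<le> cmod z")
    case True
    show thesis
    proof (cases "Re z \<le> - 1 / 2")
      case False
      then have "z = zeta \<or> z = omega" using True z by (intro Omega_fundamental) auto
      with False have "z = zeta" by (auto simp: omega_eq)
      then show thesis by (rule split(1))
    qed (use True L in blast)
  next
    case False
    show thesis
    proof (cases "cmod (1 + z) \<le> 1")
      case False': False
      \<comment> \<open>This region is empty: \<open>flip z\<close> would be a vertex in the
        fundamental polyhedron of modulus greater than 1, whereas \<open>zeta\<close> and
        \<open>omega\<close> have modulus 1.\<close>
      have w: "psl_act flip z \<in> Omega" using z(1) psl_act_Omega by simp
      have e: "psl_act flip z = - 1 / z" by (simp add: generators_act z(2))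
      have "1 < cmod (psl_act flip z)" using n(2) \<open>\<not> 1 \<le> cmod z\<close> unfolding e by (simp add: norm_divide)
      have "Re (- 1 / z) \<le> 1 / 2"
        using False' unfolding Re_divide_le_half_iff[OF n(2)] by (simp add: cmod_le_one_iff power2_eq_square algebra_simps)
      moreover have "Re (1 / z) \<le> 1 / 2"
        using z(4) unfolding Re_divide_le_half_iff[OF n(2)] by simp
      ultimately have "\<bar>Re (psl_act flip z)\<bar> \<le> 1 / 2" unfolding e by auto
      with w \<open>1 < cmod (psl_act flip z)\<close> have "psl_act flip z = zeta \<or> psl_act flip z = omega"
        by (intro Omega_fundamental) auto
      then have "cmod (psl_act flip z) = 1" by (auto simp: zeta_def omega_def)
      with \<open>1 < cmod (psl_act flip z)\<close> show thesis by simp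
    qed (use False R in auto)
  qed
qed

text \<open>The geodesics \<open>Re z = 1 / 2\<close>, \<open>cmod z = 1\<close> and
  \<open>cmod (z - 1) = 1\<close> meet at \<open>zeta\<close> and bound three sectors permuted by
  \<open>rot\<close>. In terms of \<open>Re z\<close> and \<open>(cmod z)\<^sup>2\<close> all
  conditions are linear, and the sectors cover the half-plane.\<close>

lemma Omega_branches:
  assumes "z \<in> Omega"
  shows "z \<in> branch \<or> psl_act rot z \<in> branch \<or> psl_act rot (psl_act rot z) \<in> branch"
proof -
  have U: "z \<in> UHP" using assms by (rule Omega_UHP)
  have n: "1 - z \<noteq> 0" "z \<noteq> 0" using U UHP_nz_simps by blast+
  have O: "psl_act rot z \<in> Omega" "psl_act rot (psl_act rot z) \<in> Omega"
    using assms by (simp_all add: psl_act_Omega)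
  have r: "Re (psl_act rot z) \<le> 1 / 2 \<longleftrightarrow> 1 \<le> cmod z"
    unfolding generators_act(1)[OF U] Re_divide_le_half_iff[OF n(1)]
    by (simp add: one_le_cmod_iff power2_eq_square algebra_simps)
  have "psl_act rot z - 1 = z / (1 - z)"
    unfolding generators_act(1)[OF U] using n by (simp add: eq_divide_eq left_diff_distrib)
  note rz = this
  have r': "1 \<le> cmod (psl_act rot z - 1) \<longleftrightarrow> 1 / 2 \<le> Re z"
    unfolding rz one_le_cmod_divide_iff[OF n(1)] by (simp add: power2_eq_square algebra_simps)
  have s: "Re (psl_act rot (psl_act rot z)) \<le> 1 / 2 \<longleftrightarrow> cmod (z - 1) \<le> 1"
    unfolding rot_rot[OF U] Re_divide_le_half_iff[OF n(2)]
    by (simp add: cmod_le_one_iff power2_eq_square algebra_simps)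
  have "psl_act rot (psl_act rot z) - 1 = - 1 / z" 
    unfolding rot_rot[OF U] using n by (simp add: diff_divide_distrib)
  then have s': "1 \<le> cmod (psl_act rot (psl_act rot z) - 1) \<longleftrightarrow> cmod z \<le> 1"
    using n by (simp add: norm_divide pos_le_divide_eq)
  have "(Re z \<le> 1 / 2 \<and> 1 \<le> cmod (z - 1)) \<or> (1 \<le> cmod z \<and> 1 / 2 \<le> Re z) \<or> (cmod (z - 1) \<le> 1 \<and> cmod z \<le> 1)"
    unfolding one_le_cmod_iff cmod_le_one_iff by (simp add: power2_eq_square algebra_simps) linarith
  then show ?thesis using assms O unfolding branch_def mem_Collect_eq r r' s s' by blast
qed

section \<open>Links\<close>

lemma flip_base_edge: "psl_act flip ` base_edge = base_edge"
proof -
  have f: "psl_act flip (cis t) = cis (pi - t)" if "t \<in> {pi / 3..2 * pi / 3}" for t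
  proof -
    have "cis t \<in> UHP" using that base_edge_subset_UHP by (auto simp: base_edge_def)
    then show ?thesis by (simp add: generators_act cis_divide[of 0, simplified] complex_eq_iff)
  qed
  have "(\<lambda>t. pi - t) ` {pi / 3..2 * pi / 3} = {pi / 3..2 * pi / 3}"
    by (simp add: image_diff_atLeastAtMost)
  then have "base_edge = (\<lambda>t. cis (pi - t)) ` {pi / 3..2 * pi / 3}"
    unfolding base_edge_def by (metis image_image)
  also have "\<dots> = psl_act flip ` base_edge"
    unfolding base_edge_def image_image using f by (intro image_cong) simp_all
  finally show ?thesis ..
qed

lemma act_mult_image:
  assumes "C \<in> carrier PSL2Z" "D \<in> carrier PSL2Z" "E \<subseteq> UHP"
  shows "psl_act (C \<otimes>\<^bsub>PSL2Z\<^esub> D) ` E = psl_act C ` psl_act D ` E"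
  unfolding image_image using assms by (intro image_cong) (auto simp: psl_act_mult)

text \<open>Every edge can be oriented so as to start at a prescribed endpoint: if \<open>C\<close>
  gives the wrong orientation, \<open>C\<close> followed on the right by \<open>flip\<close> gives
  the other one with the same arc.\<close>

lemma tree_edge_cases:
  assumes "A \<in> tree_edges" "edge_ends A = {v, a}"
  obtains C where "C \<in> carrier PSL2Z" "A = psl_act C ` base_edge" "v = psl_act C zeta" "a = psl_act C omega"
proof -
  interpret group PSL2Z by (rule group_PSL2Z)
  from assms(1) obtain C where C: "C \<in> carrier PSL2Z" "A = psl_act C ` base_edge" by (auto simp: tree_edges_def)
  then have "{v, a} = {psl_act C zeta, psl_act C omega}"
    using assms(2) edge_ends_translate[OF C(1)] by (simp add: zeta_def omega_def)
  then consider "v = psl_act C zeta" "a = psl_act C omega" | "v = psl_act C omega" "a = psl_act C zeta"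
    by (auto simp: doubleton_eq_iff)
  then show thesis
  proof cases
    case 1
    then show thesis using that C by blast
  next
    case 2
    have "A = psl_act (C \<otimes>\<^bsub>PSL2Z\<^esub> flip) ` base_edge"
      using C base_edge_subset_UHP by (simp add: act_mult_image flip_base_edge)
    then show thesis using 2 C
      by (intro that[of "C \<otimes>\<^bsub>PSL2Z\<^esub> flip"]) (simp_all add: psl_act_mult generator_values)
  qed
qed

lemma edge_ends_act:
  "C \<in> carrier PSL2Z \<Longrightarrow> edge_ends (psl_act C ` base_edge) = {psl_act C zeta, psl_act C omega}"
  using edge_ends_translate by (simp add: zeta_def omega_def)

section \<open>Tangent directions at a vertex and the cyclic order of a link\<close>

lemma continuous_on_act:
  assumes "C \<in> carrier PSL2Z"
  shows "continuous_on UHP (psl_act C)"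
proof -
  from assms obtain A where A: "det A = 1" "C = {A, - A}" by (auto simp: carrier_PSL2Z)
  have "continuous_on UHP (moebius_map A)"
    unfolding moebius_map_def using moebius_denom_nz[OF A(1)] by (intro continuous_intros) auto
  then show ?thesis by (rule continuous_on_eq) (simp add: A(2) psl_act_coset)
qed

text \<open>Conformality: \<open>1 / (c v + d)\<^sup>2\<close> is the derivative of the
  transformation at \<open>v\<close>, and its argument \<open>s\<close> is the angle by which
  directions at \<open>v\<close> are turned.\<close>

lemma departs_translate:
  assumes "a * d - b * c = 1" "v \<in> UHP" "E \<subseteq> UHP" "departs E v t"
    and "cis s = sgn (1 / (of_int c * v + of_int d)\<^sup>2)"
  shows "departs (psl_act (mob a b c d) ` E) (psl_act (mob a b c d) v) (t + s)"
proof -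
  interpret group PSL2Z by (rule group_PSL2Z)
  define C where "C = mob a b c d"
  define D where "D = inv\<^bsub>PSL2Z\<^esub> C"
  have C: "C \<in> carrier PSL2Z" using assms(1) by (simp add: C_def mob_carrier)
  then have D: "D \<in> carrier PSL2Z" by (simp add: D_def)
  have DC: "psl_act D (psl_act C z) = z" if "z \<in> UHP" for z using psl_act_inv C that by (simp add: D_def)
  define q where "q z = complex_of_int c * z + of_int d" for z
  have q: "q z \<noteq> 0" if "z \<in> UHP" for z
    using moebius_denom_nz[of "vector [vector [a, b], vector [c, d]]" z] assms(1) that
    by (simp add: q_def det_2)
  \<comment> \<open>This exact formula replaces differentiation: since \<open>sgn\<close> is
    multiplicative, the direction of the image chord is the direction of \<open>z - v\<close> times
    a factor continuous in \<open>z\<close>.\<close>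
  have diff: "psl_act C z - psl_act C v = (z - v) * (1 / (q z * q v))" if "z \<in> UHP" for z
  proof -
    have 1: "of_int a * of_int d - of_int b * of_int c = (1 :: complex)"
      using assms(1) by (metis of_int_1 of_int_diff of_int_mult)
    have "psl_act C z - psl_act C v = (of_int a * z + of_int b) / q z - (of_int a * v + of_int b) / q v"
      using that assms(2) by (simp add: C_def psl_act_mob q_def)
    also have "\<dots> = ((of_int a * z + of_int b) * q v - (of_int a * v + of_int b) * q z) / (q z * q v)"
      using q that assms(2) by (simp add: diff_frac_eq)
    also have "(of_int a * z + of_int b) * q v - (of_int a * v + of_int b) * q z =
        (of_int a * of_int d - of_int b * of_int c) * (z - v)"
      by (simp add: q_def algebra_simps)
    finally show ?thesis by (simp add: 1)
  qed
  define F where "F z = sgn (z - v) * sgn (1 / (q z * q v))" for z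
  have "((\<lambda>z. sgn (1 / (q z * q v))) \<longlongrightarrow> sgn (1 / (q v * q v))) (at v within E)"
    unfolding q_def using q[OF assms(2)] by (intro tendsto_intros) (auto simp: q_def)
  then have F: "(F \<longlongrightarrow> cis (t + s)) (at v within E)"
    using assms(4,5) unfolding F_def departs_def cis_mult[symmetric]
    by (intro tendsto_mult) (simp_all add: q_def power2_eq_square)
  \<comment> \<open>Continuity of the inverse \<open>D\<close> turns the limit along
    \<open>E\<close> at \<open>v\<close> into a limit along the image arc.\<close>
  have "(psl_act D \<longlongrightarrow> psl_act D (psl_act C v)) (at (psl_act C v) within UHP)"
    using continuous_on_act[OF D] psl_act_closed[OF C assms(2)] by (simp add: continuous_on_def)
  then have "(psl_act D \<longlongrightarrow> v) (at (psl_act C v) within psl_act C ` E)"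
    unfolding DC[OF assms(2)] by (rule tendsto_within_subset) (use C assms(3) psl_act_closed in blast)
  moreover have "\<forall>\<^sub>F w in at (psl_act C v) within psl_act C ` E. psl_act D w \<in> E \<and> psl_act D w \<noteq> v"
    unfolding eventually_at_filter using DC assms(3) by (intro always_eventually) auto
  ultimately have "filterlim (psl_act D) (at v within E) (at (psl_act C v) within psl_act C ` E)"
    by (simp add: filterlim_at)
  with F have "((\<lambda>w. F (psl_act D w)) \<longlongrightarrow> cis (t + s)) (at (psl_act C v) within psl_act C ` E)"
    by (rule filterlim_compose)
  moreover have "\<forall>\<^sub>F w in at (psl_act C v) within psl_act C ` E. F (psl_act D w) = sgn (w - psl_act C v)"
    unfolding eventually_at_filter F_def using DC diff assms(3)
    by (intro always_eventually) (auto simp: subset_iff simp flip: sgn_mult)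
  ultimately show ?thesis unfolding departs_def C_def[symmetric] by (rule Lim_transform_eventually)
qed

text \<open>The angle \<open>s\<close> depends on \<open>C\<close> and \<open>v\<close> but not on
  the arc, so all edges at \<open>v\<close> are turned by the same amount and their cyclic order is
  kept.\<close>

lemma departs_act:
  assumes "C \<in> carrier PSL2Z" "v \<in> UHP"
  obtains s where "\<And>E t. E \<subseteq> UHP \<Longrightarrow> departs E v t \<Longrightarrow> departs (psl_act C ` E) (psl_act C v) (t + s)"
proof -
  from assms(1) obtain a b c d where C: "a * d - b * c = 1" "C = mob a b c d" by (rule PSL2Z_cases)
  have "of_int c * v + of_int d \<noteq> 0"
    using moebius_denom_nz[of "vector [vector [a, b], vector [c, d]]" v] C(1) assms(2) by (simp add: det_2)
  then have "cis (Arg (1 / (of_int c * v + of_int d)\<^sup>2)) = sgn (1 / (of_int c * v + of_int d)\<^sup>2)"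
    by (intro cis_Arg) auto
  then show thesis using C assms(2) departs_translate by (intro that) blast
qed

lemma departs_base_edge: "departs base_edge zeta (5 * pi / 6)"
proof -
  have s: "sgn (z - zeta) = \<i> * cis ((Arg z + pi / 3) / 2)" if z: "z \<in> base_edge" "z \<noteq> zeta" for z
  proof -
    from z obtain t where t: "pi / 3 \<le> t" "t \<le> 2 * pi / 3" "z = cis t" by (auto simp: base_edge_def)
    with z(2) have "pi / 3 < t" by (cases "t = pi / 3") (auto simp: zeta_def)
    have "0 < t" using t(1) pi_gt_zero by linarith
    then have "t \<in> {- pi<..pi}" using t(2) pi_gt_zero by simp
    then have "Arg z = t" unfolding t(3) by (rule Arg_cis)
    \<comment> \<open>Half difference and half sum of the angles: the chord from
      \<open>cis (w - u)\<close> to \<open>cis (w + u)\<close> is a positive multiple of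
      \<open>\<i> * cis w\<close>. In the limit \<open>w\<close> becomes
      \<open>pi / 3\<close>.\<close>
    define u where "u = (t - pi / 3) / 2"
    define w where "w = (t + pi / 3) / 2"
    have tu: "t = w + u" "pi / 3 = w - u" by (simp_all add: u_def w_def field_simps)
    have "0 < sin u" using \<open>pi / 3 < t\<close> t(2) pi_gt_zero by (intro sin_gt_zero) (simp_all add: u_def)
    have "z - zeta = cis (w + u) - cis (w - u)" unfolding t(3) zeta_def tu(1)[symmetric] tu(2)[symmetric] ..
    also have "\<dots> = of_real (2 * sin u) * (\<i> * cis w)"
      by (simp add: complex_eq_iff cos_add cos_diff sin_add sin_diff)
    finally have "sgn (z - zeta) = sgn (of_real (2 * sin u)) * sgn (\<i> * cis w)"
      by (simp only: sgn_mult)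
    moreover have "sgn (\<i> * cis w) = \<i> * cis w" by (simp add: sgn_div_norm norm_mult)
    moreover have "sgn (of_real (2 * sin u) :: complex) = 1"
      using \<open>0 < sin u\<close> by (simp only: sgn_of_real) simp
    ultimately show ?thesis using \<open>Arg z = t\<close> by (simp add: w_def)
  qed
  have "zeta \<notin> \<real>\<^sub>\<le>\<^sub>0" by (simp add: zeta_eq complex_nonpos_Reals_iff)
  then have "((\<lambda>z. \<i> * cis ((Arg z + pi / 3) / 2)) \<longlongrightarrow> \<i> * cis ((Arg zeta + pi / 3) / 2)) (at zeta within base_edge)"
    unfolding cis_conv_exp
    by (intro tendsto_intros tendsto_Arg) auto
  moreover have "\<i> * cis ((Arg zeta + pi / 3) / 2) = cis (5 * pi / 6)"
  proof -
    have "Arg zeta = pi / 3" unfolding zeta_def using pi_gt_zero by (subst Arg_cis) auto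
    then have "(Arg zeta + pi / 3) / 2 = pi / 3" by simp
    then have "\<i> * cis ((Arg zeta + pi / 3) / 2) = cis (pi / 2) * cis (pi / 3)" by (simp only:) simp
    also have "\<dots> = cis (5 * pi / 6)" unfolding cis_mult by (simp add: field_simps)
    finally show ?thesis .
  qed
  ultimately have "((\<lambda>z. \<i> * cis ((Arg z + pi / 3) / 2)) \<longlongrightarrow> cis (5 * pi / 6)) (at zeta within base_edge)"
    by simp
  moreover have "\<forall>\<^sub>F z in at zeta within base_edge. \<i> * cis ((Arg z + pi / 3) / 2) = sgn (z - zeta)"
    unfolding eventually_at_filter using s by (intro always_eventually) auto
  ultimately show ?thesis unfolding departs_def by (rule Lim_transform_eventually)
qed

text \<open>The derivative of \<open>rot\<close> at \<open>zeta\<close> is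
  \<open>1 / (1 - zeta)\<^sup>2\<close>, and \<open>1 - zeta = cis (- (pi / 3))\<close>.\<close>

lemma departs_rot:
  assumes "E \<subseteq> UHP" "departs E zeta t"
  shows "departs (psl_act rot ` E) zeta (t + 2 * pi / 3)"
proof -
  have "of_int (- 1) * zeta + of_int 1 = cis (- (pi / 3))"
    by (simp add: zeta_def complex_eq_iff cos_60 sin_60)
  then have "1 / (of_int (- 1) * zeta + of_int 1)\<^sup>2 = cis (2 * pi / 3)"
    using cis_divide[of 0 "- (2 * pi / 3)"] by (simp add: Complex.DeMoivre)
  then have "departs (psl_act (mob 0 1 (- 1) 1) ` E) (psl_act (mob 0 1 (- 1) 1) zeta) (t + 2 * pi / 3)"
    using assms by (intro departs_translate) (simp_all add: sgn_div_norm)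
  then show ?thesis using generator_values(1) by (simp add: rot_def)
qed

text \<open>The arc is connected and has more than one point, so its endpoint is a limit point and
  limits along it are unique.\<close>

lemma departs_unique:
  assumes "C \<in> carrier PSL2Z" "departs (psl_act C ` base_edge) (psl_act C zeta) s"
    "departs (psl_act C ` base_edge) (psl_act C zeta) t"
  shows "cis s = cis t"
proof -
  have z: "zeta \<in> base_edge" "omega \<in> base_edge" using base_edge_Omega by (auto simp: zeta_def omega_def)
  have "psl_act C zeta \<noteq> psl_act C omega"
  proof
    assume "psl_act C zeta = psl_act C omega"
    then have "zeta = omega" using psl_act_inv(1)[OF assms(1)] zeta_UHP omega_UHP by metis
    then show False by (simp add: zeta_eq omega_eq)
  qed
  then have ne: "psl_act C ` base_edge \<noteq> {x}" for x using z by (metis imageI singletonD)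
  have "connected (cis ` {pi / 3..2 * pi / 3})"
    by (rule connected_continuous_image) (rule continuous_on_cis[OF continuous_on_id], simp)
  then have "connected (psl_act C ` base_edge)"
    using continuous_on_subset[OF continuous_on_act[OF assms(1)] base_edge_subset_UHP]
    unfolding base_edge_def[symmetric] by (rule connected_continuous_image[rotated])
  then have "psl_act C zeta islimpt psl_act C ` base_edge"
    using imageI[OF z(1)] ne by (rule connected_imp_perfect)
  then have "\<not> trivial_limit (at (psl_act C zeta) within psl_act C ` base_edge)"
    by (simp add: trivial_limit_within)
  then show ?thesis using assms(2,3) unfolding departs_def by (rule tendsto_unique)
qed

lemma cis_eq_imp_eq:
  assumes "cis x = cis y" "\<bar>x - y\<bar> < 2 * pi"
  shows "x = y"
proof -
  have "cis (x - y) = 1" using assms(1) by (simp flip: cis_divide)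
  then have "cos (x - y) = 1" by (simp add: complex_eq_iff)
  then obtain n :: int where n: "x - y = of_int n * 2 * pi" by (auto simp: cos_one_2pi_int)
  then have "\<bar>of_int n\<bar> * (2 * pi) < 1 * (2 * pi)" using assms(2) by (simp add: abs_mult)
  then have "\<bar>real_of_int n\<bar> < 1" using pi_gt_zero by (simp only: mult_less_cancel_right)
  then have "n = 0" by linarith
  then show ?thesis using n by simp
qed

text \<open>Removes all analysis from the notion of a link: the three edges at a vertex leave at
  equal angles \<open>2 * pi / 3\<close>, so the counterclockwise triples are exactly the translates
  of the one at \<open>zeta\<close> under the group.\<close>

lemma link_ccw_iff:
  "link_ccw v a b c \<longleftrightarrow> (\<exists>C\<in>carrier PSL2Z. v = psl_act C zeta \<and> a = psl_act C omega \<and>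
     b = psl_act C (psl_act rot omega) \<and> c = psl_act C (psl_act rot (psl_act rot omega)))"
  (is "_ \<longleftrightarrow> ?R")
proof -
  interpret group PSL2Z by (rule group_PSL2Z)
  note U = base_edge_subset_UHP
  have RU: "psl_act rot ` base_edge \<subseteq> UHP" using U psl_act_closed by auto
  note d0 = departs_base_edge
  note d1 = departs_rot[OF U d0]
  note d2 = departs_rot[OF RU d1]
  show ?thesis
  proof
    assume ?R
    then obtain C where C: "C \<in> carrier PSL2Z" and v: "v = psl_act C zeta" "a = psl_act C omega"
      "b = psl_act C (psl_act rot omega)" "c = psl_act C (psl_act rot (psl_act rot omega))" by blast
    obtain s where s: "\<And>E t. E \<subseteq> UHP \<Longrightarrow> departs E zeta t \<Longrightarrow> departs (psl_act C ` E) (psl_act C zeta) (t + s)"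
      using departs_act[OF C zeta_UHP] by blast
    define D where "D = C \<otimes>\<^bsub>PSL2Z\<^esub> rot"
    define E where "E = D \<otimes>\<^bsub>PSL2Z\<^esub> rot"
    have DE: "D \<in> carrier PSL2Z" "E \<in> carrier PSL2Z" using C by (simp_all add: D_def E_def)
    have i: "psl_act D ` base_edge = psl_act C ` psl_act rot ` base_edge"
      "psl_act E ` base_edge = psl_act C ` psl_act rot ` psl_act rot ` base_edge"
      using C U RU DE unfolding E_def D_def by (simp_all add: act_mult_image)
    have "edge_ends (psl_act C ` base_edge) = {v, a}" using C by (simp add: edge_ends_act v)
    moreover have "edge_ends (psl_act D ` base_edge) = {v, b}"
      using DE(1) C by (simp add: edge_ends_act v) (simp add: D_def psl_act_mult generator_values(1))
    moreover have "edge_ends (psl_act E ` base_edge) = {v, c}"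
      using DE C by (simp add: edge_ends_act v)
        (simp add: E_def D_def psl_act_mult psl_act_closed generator_values(1))
    moreover have "departs (psl_act C ` base_edge) v (5 * pi / 6 + s)" unfolding v using s[OF U d0] .
    moreover have "departs (psl_act D ` base_edge) v (5 * pi / 6 + 2 * pi / 3 + s)" unfolding v i using s[OF RU d1] .
    moreover have "departs (psl_act E ` base_edge) v (5 * pi / 6 + 2 * pi / 3 + 2 * pi / 3 + s)"
      unfolding v i by (rule s[OF _ d2]) (use RU psl_act_closed in auto)
    moreover have "psl_act C ` base_edge \<in> tree_edges" "psl_act D ` base_edge \<in> tree_edges"
      "psl_act E ` base_edge \<in> tree_edges"
      using C DE by (auto simp: tree_edges_def)
    moreover have "5 * pi / 6 + s < 5 * pi / 6 + 2 * pi / 3 + s"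
      "5 * pi / 6 + 2 * pi / 3 + s < 5 * pi / 6 + 2 * pi / 3 + 2 * pi / 3 + s"
      "5 * pi / 6 + 2 * pi / 3 + 2 * pi / 3 + s < 5 * pi / 6 + s + 2 * pi"
      using pi_gt_zero by simp_all
    ultimately show "link_ccw v a b c" unfolding link_ccw_def by blast
  next
    assume "link_ccw v a b c"
    then obtain X Y Z r s t where
      E: "X \<in> tree_edges" "Y \<in> tree_edges" "Z \<in> tree_edges"
        "edge_ends X = {v, a}" "edge_ends Y = {v, b}" "edge_ends Z = {v, c}" and
      rst: "r < s" "s < t" "t < r + 2 * pi" and d: "departs X v r" "departs Y v s" "departs Z v t"
      unfolding link_ccw_def by blast
    from E(1,4) obtain C where C: "C \<in> carrier PSL2Z" "X = psl_act C ` base_edge"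
      "v = psl_act C zeta" "a = psl_act C omega" by (rule tree_edge_cases)
    obtain \<alpha> where \<alpha>: "\<And>E t. E \<subseteq> UHP \<Longrightarrow> departs E zeta t \<Longrightarrow> departs (psl_act C ` E) (psl_act C zeta) (t + \<alpha>)"
      using departs_act[OF C(1) zeta_UHP] by blast
    have cr: "cis r = cis (5 * pi / 6 + \<alpha>)"
      using departs_unique[OF C(1)] d(1) \<alpha>[OF U d0] C by blast
    \<comment> \<open>An edge at \<open>v\<close> has the form \<open>C G\<close> with
      \<open>G\<close> in the stabilizer of \<open>zeta\<close>. The identity is excluded because
      \<open>s'\<close> lies strictly between \<open>r\<close> and \<open>r + 2 * pi\<close>; the
      two rotations give the two alternatives.\<close>
    have other: "b' = psl_act C (psl_act rot omega) \<and> cis s' = cis (r + 2 * pi / 3) \<or>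
        b' = psl_act C (psl_act rot (psl_act rot omega)) \<and> cis s' = cis (r + 4 * pi / 3)"
      if Y: "Y \<in> tree_edges" "edge_ends Y = {v, b'}" "departs Y v s'" "r < s'" "s' < r + 2 * pi" for Y b' s'
    proof -
      from Y(1,2) obtain D where D: "D \<in> carrier PSL2Z" "Y = psl_act D ` base_edge"
        "v = psl_act D zeta" "b' = psl_act D omega" by (rule tree_edge_cases)
      define G where "G = inv\<^bsub>PSL2Z\<^esub> C \<otimes>\<^bsub>PSL2Z\<^esub> D"
      have G: "G \<in> carrier PSL2Z" using C D by (simp add: G_def)
      have GD: "psl_act D z = psl_act C (psl_act G z)" if "z \<in> UHP" for z
        using C D that by (simp add: G_def psl_act_mult psl_act_inv psl_act_closed)
      have "psl_act G zeta = zeta"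
        using C D psl_act_inv(1)[OF C(1) zeta_UHP] by (simp add: G_def psl_act_mult)
      have DG: "psl_act D ` base_edge = psl_act C ` psl_act G ` base_edge"
        unfolding image_image using GD U by (intro image_cong) auto
      have dD: "cis s' = cis t'" if "departs (psl_act G ` base_edge) zeta t" "t' = t + \<alpha>" for t t'
      proof -
        have "departs (psl_act D ` base_edge) (psl_act C zeta) (t + \<alpha>)"
          unfolding DG by (rule \<alpha>[OF _ that(1)]) (use U G psl_act_closed in auto)
        then show ?thesis using departs_unique[OF D(1)] Y(3) D C(3) that(2) by metis
      qed
      have cis_add: "cis (x + y) = cis (x' + y)" if "cis x = cis x'" for x x' y
        using that by (simp flip: cis_mult)
      from stab_zeta[OF G \<open>psl_act G zeta = zeta\<close>] show ?thesis
      proof cases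
        case 1
        then have "psl_act G ` base_edge = base_edge" using U by force
        then have "cis s' = cis r" using dD[of "5 * pi / 6"] d0 cr by simp
        then have "s' = r" by (rule cis_eq_imp_eq) (use Y(4,5) in simp)
        then show ?thesis using Y(4) by simp
      next
        case 2
        then have "psl_act G ` base_edge = psl_act rot ` base_edge" using U by (intro image_cong) auto
        then have "cis s' = cis (5 * pi / 6 + 2 * pi / 3 + \<alpha>)" using dD d1 by simp
        also have "\<dots> = cis (r + 2 * pi / 3)" using cis_add[OF cr, of "2 * pi / 3"] by (simp add: algebra_simps)
        finally show ?thesis using 2 D(4) GD by simp
      next
        case 3
        then have "psl_act G ` base_edge = psl_act rot ` psl_act rot ` base_edge"
          unfolding image_image using U by (intro image_cong) auto
        then have "cis s' = cis (5 * pi / 6 + 2 * pi / 3 + 2 * pi / 3 + \<alpha>)" using dD d2 by simp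
        also have "\<dots> = cis (r + 4 * pi / 3)" using cis_add[OF cr, of "4 * pi / 3"] by (simp add: algebra_simps)
        finally show ?thesis using 3 D(4) GD by simp
      qed
    qed
    have val: "x = y" if "cis x = cis y" "r < x" "x < r + 2 * pi" "r < y" "y < r + 2 * pi" for x y
      using that(1) by (rule cis_eq_imp_eq) (use that in simp)
    have s: "b = psl_act C (psl_act rot omega) \<and> s = r + 2 * pi / 3 \<or>
        b = psl_act C (psl_act rot (psl_act rot omega)) \<and> s = r + 4 * pi / 3"
      using other[OF E(2,5) d(2)] rst val[of s "r + 2 * pi / 3"] val[of s "r + 4 * pi / 3"] pi_gt_zero by auto
    have t: "c = psl_act C (psl_act rot omega) \<and> t = r + 2 * pi / 3 \<or>
        c = psl_act C (psl_act rot (psl_act rot omega)) \<and> t = r + 4 * pi / 3"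
      using other[OF E(3,6) d(3)] rst val[of t "r + 2 * pi / 3"] val[of t "r + 4 * pi / 3"] pi_gt_zero by auto
    \<comment> \<open>Each of \<open>s\<close> and \<open>t\<close> has two possible values, and
      \<open>s < t\<close> leaves one combination.\<close>
    from s t rst pi_gt_zero have "b = psl_act C (psl_act rot omega)" "c = psl_act C (psl_act rot (psl_act rot omega))"
      by auto
    with C show ?R by blast
  qed
qed

section \<open>Edges separated by polyhedral pieces\<close>

text \<open>If the squares agree, then \<open>a\<close> and \<open>c\<close> divide each other and
  hence the determinant 1. Otherwise \<open>\<bar>a\<bar> + \<bar>c\<bar>\<close> is a factor of 1
  or -1.\<close>

lemma abs_le_one_if_square_diff_small:
  fixes a b c d :: int
  assumes "a * d - b * c = 1" "\<bar>a\<^sup>2 - c\<^sup>2\<bar> \<le> 1"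
  shows "\<bar>a\<bar> \<le> 1 \<and> \<bar>c\<bar> \<le> 1"
proof (cases "a\<^sup>2 - c\<^sup>2 = 0")
  case True
  then have "\<bar>a\<bar> = \<bar>c\<bar>" by (simp add: power2_eq_iff abs_eq_iff)
  then have "a dvd c" "c dvd a" by (metis abs_dvd_iff dvd_abs_iff dvd_refl)+
  then have "a dvd a * d - b * c" "c dvd a * d - b * c" by simp_all
  then show ?thesis unfolding assms(1) by simp
next
  case False
  have "(\<bar>a\<bar> + \<bar>c\<bar>) * (\<bar>a\<bar> - \<bar>c\<bar>) = a\<^sup>2 - c\<^sup>2" by (simp add: algebra_simps flip: power2_eq_square)
  moreover have "a\<^sup>2 - c\<^sup>2 = 1 \<or> a\<^sup>2 - c\<^sup>2 = - 1" using False assms(2) by linarith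
  ultimately have "\<bar>a\<bar> + \<bar>c\<bar> dvd 1" by (metis dvd_minus_iff dvd_triv_left)
  then have "\<bar>a\<bar> + \<bar>c\<bar> = 1" by simp
  then show ?thesis by linarith
qed

lemma cmod_lattice_zeta: "(Re (of_int c * zeta + of_int d))\<^sup>2 + (Im (of_int c * zeta + of_int d))\<^sup>2 =
    of_int (c\<^sup>2 + c * d + d\<^sup>2)"
  by (simp add: zeta_eq) (simp add: power2_eq_square field_simps)

lemma cmod_lattice_omega: "(Re (of_int c * omega + of_int d))\<^sup>2 + (Im (of_int c * omega + of_int d))\<^sup>2 =
    of_int (c\<^sup>2 - c * d + d\<^sup>2)"
  by (simp add: omega_eq) (simp add: power2_eq_square field_simps)

text \<open>\<open>C zeta\<close> and \<open>C omega\<close> lie outside the open unit disc when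
  \<open>\<alpha> + \<gamma> + y\<close> and \<open>\<alpha> + \<gamma> - y\<close>, respectively,
  are nonnegative. If exactly one holds, then
  \<open>\<bar>\<alpha> + \<gamma>\<bar> \<le> \<bar>y\<bar>\<close>, and the discriminant identity
  turns this into a bound on the definite form
  \<open>\<alpha>\<^sup>2 + \<alpha> \<gamma> + \<gamma>\<^sup>2\<close>.\<close>

lemma finite_edges_crossing_unit_circle:
  "finite {C \<in> carrier PSL2Z. (1 \<le> cmod (psl_act C zeta)) \<noteq> (1 \<le> cmod (psl_act C omega))}" (is "finite ?X")
proof (rule finite_subset)
  let ?I = "{- 1..1 :: int}"
  show "finite ((\<lambda>(a, b, c, d). mob a b c d) ` (?I \<times> ?I \<times> ?I \<times> ?I))" by simp
  show "?X \<subseteq> (\<lambda>(a, b, c, d). mob a b c d) ` (?I \<times> ?I \<times> ?I \<times> ?I)"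
  proof
    fix C assume C: "C \<in> ?X"
    then have "C \<in> carrier PSL2Z" by simp
    then obtain a b c d where abcd: "a * d - b * c = 1" "C = mob a b c d" by (rule PSL2Z_cases)
    have q: "of_int c * z + of_int d \<noteq> 0" if "z \<in> UHP" for z
      using moebius_denom_nz[of "vector [vector [a, b], vector [c, d]]" z] abcd(1) that by (simp add: det_2)
    define \<alpha> \<gamma> y where "\<alpha> = a\<^sup>2 - c\<^sup>2" and "\<gamma> = b\<^sup>2 - d\<^sup>2" and "y = a * b - c * d"
    have "1 \<le> cmod (psl_act C zeta) \<longleftrightarrow> 0 \<le> \<alpha> + \<gamma> + y"
      unfolding abcd(2) psl_act_mob[OF zeta_UHP] one_le_cmod_divide_iff[OF q[OF zeta_UHP]] cmod_lattice_zeta of_int_le_iff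
      by (simp add: \<alpha>_def \<gamma>_def y_def) linarith
    moreover have "1 \<le> cmod (psl_act C omega) \<longleftrightarrow> 0 \<le> \<alpha> + \<gamma> - y"
      unfolding abcd(2) psl_act_mob[OF omega_UHP] one_le_cmod_divide_iff[OF q[OF omega_UHP]] cmod_lattice_omega of_int_le_iff
      by (simp add: \<alpha>_def \<gamma>_def y_def) linarith
    ultimately have "(0 \<le> \<alpha> + \<gamma> + y) \<noteq> (0 \<le> \<alpha> + \<gamma> - y)" using C by simp
    then have "\<bar>\<alpha> + \<gamma>\<bar> \<le> \<bar>y\<bar>" by linarith
    then have "(\<alpha> + \<gamma>)\<^sup>2 \<le> y\<^sup>2" by (simp add: abs_le_square_iff)
    \<comment> \<open>The half-plane is the positivity set of a quadratic form with fixed discriminant.\<close>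
    also have "y\<^sup>2 = (a * d - b * c)\<^sup>2 + \<alpha> * \<gamma>"
      by (simp add: \<alpha>_def \<gamma>_def y_def power2_eq_square algebra_simps)
    finally have *: "\<alpha>\<^sup>2 + \<alpha> * \<gamma> + \<gamma>\<^sup>2 \<le> 1" unfolding abcd(1) by (simp add: power2_eq_square algebra_simps)
    have "3 * \<alpha>\<^sup>2 \<le> (2 * \<gamma> + \<alpha>)\<^sup>2 + 3 * \<alpha>\<^sup>2" by simp
    also have "\<dots> = 4 * (\<alpha>\<^sup>2 + \<alpha> * \<gamma> + \<gamma>\<^sup>2)" by (simp add: power2_eq_square algebra_simps)
    also have "\<dots> \<le> 4" using * by simp
    finally have "\<alpha>\<^sup>2 \<le> 1" by simp
    have "3 * \<gamma>\<^sup>2 \<le> (2 * \<alpha> + \<gamma>)\<^sup>2 + 3 * \<gamma>\<^sup>2" by simp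
    also have "\<dots> = 4 * (\<alpha>\<^sup>2 + \<alpha> * \<gamma> + \<gamma>\<^sup>2)" by (simp add: power2_eq_square algebra_simps)
    also have "\<dots> \<le> 4" using * by simp
    finally have "\<gamma>\<^sup>2 \<le> 1" by simp
    with \<open>\<alpha>\<^sup>2 \<le> 1\<close> have "\<bar>\<alpha>\<bar> \<le> 1" "\<bar>\<gamma>\<bar> \<le> 1" by (simp_all add: abs_square_le_1)
    \<comment> \<open>The second column is treated by exchanging the columns and negating one of
      them, which keeps the determinant 1.\<close>
    then have "\<bar>a\<bar> \<le> 1 \<and> \<bar>c\<bar> \<le> 1" "\<bar>b\<bar> \<le> 1 \<and> \<bar>d\<bar> \<le> 1"
      using abs_le_one_if_square_diff_small[of a d b c] abs_le_one_if_square_diff_small[of b "- c" "- a" d] abcd(1)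
      by (simp_all add: \<alpha>_def \<gamma>_def algebra_simps)
    then have "(a, b, c, d) \<in> ?I \<times> ?I \<times> ?I \<times> ?I" by auto
    with abcd(2) show "C \<in> (\<lambda>(a, b, c, d). mob a b c d) ` (?I \<times> ?I \<times> ?I \<times> ?I)" by (intro image_eqI[of _ _ "(a, b, c, d)"]) simp_all
  qed
qed

lemma mem_act_image_iff:
  assumes "C \<in> carrier PSL2Z" "L \<subseteq> UHP" "z \<in> UHP"
  shows "z \<in> psl_act C ` L \<longleftrightarrow> psl_act (inv\<^bsub>PSL2Z\<^esub> C) z \<in> L"
proof
  assume "z \<in> psl_act C ` L"
  then obtain y where "y \<in> L" "z = psl_act C y" by blast
  with assms show "psl_act (inv\<^bsub>PSL2Z\<^esub> C) z \<in> L" using psl_act_inv(1)[OF assms(1), of y] by auto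
next
  assume "psl_act (inv\<^bsub>PSL2Z\<^esub> C) z \<in> L"
  then show "z \<in> psl_act C ` L" using psl_act_inv(2)[OF assms(1,3)] by force
qed

text \<open>
  All three sides of the fundamental polyhedron lie in one orbit of lines, so a single
  half-plane suffices.
\<close>

lemma base_halfplane_unit_disc:
  assumes "K \<in> base_halfplanes"
  obtains D where "D \<in> carrier PSL2Z" "K = {z \<in> UHP. 1 \<le> cmod (psl_act D z)}"
proof -
  have "1 \<le> cmod (psl_act (mob 1 0 0 1) z) \<longleftrightarrow> 1 \<le> cmod z" if "z \<in> UHP" for z
    using that by (simp add: psl_act_mob)
  moreover have "1 \<le> cmod (psl_act (mob 1 (- 1) 1 0) z) \<longleftrightarrow> Re z \<le> 1 / 2" if z: "z \<in> UHP" for z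
  proof -
    have "z \<noteq> 0" using z UHP_nz_simps by blast
    then show ?thesis using z
      by (simp add: psl_act_mob one_le_cmod_divide_iff power2_eq_square algebra_simps)
  qed
  moreover have "1 \<le> cmod (psl_act (mob (- 1) (- 1) 1 0) z) \<longleftrightarrow> - 1 / 2 \<le> Re z" if z: "z \<in> UHP" for z
  proof -
    have "z \<noteq> 0" using z UHP_nz_simps by blast
    then have "1 \<le> cmod ((- z - 1) / z) \<longleftrightarrow> - 1 / 2 \<le> Re z"
      by (subst one_le_cmod_divide_iff) (simp_all add: power2_eq_square algebra_simps, linarith)
    then show ?thesis using z by (simp add: psl_act_mob)
  qed
  moreover have "mob 1 0 0 1 \<in> carrier PSL2Z" "mob 1 (- 1) 1 0 \<in> carrier PSL2Z"
    "mob (- 1) (- 1) 1 0 \<in> carrier PSL2Z" by (simp_all add: mob_carrier)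
  ultimately have "\<exists>D\<in>carrier PSL2Z. K = {z \<in> UHP. 1 \<le> cmod (psl_act D z)}"
    using assms unfolding base_halfplanes_def insert_iff empty_iff
    by (elim disjE FalseE) ((rule bexI[of _ "mob 1 0 0 1"]; auto), (rule bexI[of _ "mob 1 (- 1) 1 0"]; auto),
        (rule bexI[of _ "mob (- 1) (- 1) 1 0"]; auto))
  then show thesis using that by blast
qed

text \<open>The half-plane is the preimage under some \<open>D\<close> of the complement of the open
  unit disc, so left multiplication by \<open>D\<close> carries its crossing edges to those of the
  unit circle.\<close>

lemma finite_edges_crossing_halfplane:
  assumes "K \<in> halfplanes"
  shows "finite {C \<in> carrier PSL2Z. (psl_act C zeta \<in> K) \<noteq> (psl_act C omega \<in> K)}"
proof -
  interpret group PSL2Z by (rule group_PSL2Z)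
  let ?X = "{C \<in> carrier PSL2Z. (1 \<le> cmod (psl_act C zeta)) \<noteq> (1 \<le> cmod (psl_act C omega))}"
  from assms obtain A L where A: "A \<in> carrier PSL2Z" "L \<in> base_halfplanes" "K = psl_act A ` L"
    by (auto simp: halfplanes_def)
  obtain B where B: "B \<in> carrier PSL2Z" "L = {z \<in> UHP. 1 \<le> cmod (psl_act B z)}"
    using base_halfplane_unit_disc[OF A(2)] .
  define D where "D = B \<otimes>\<^bsub>PSL2Z\<^esub> inv\<^bsub>PSL2Z\<^esub> A"
  have D: "D \<in> carrier PSL2Z" using A B by (simp add: D_def)
  have K: "z \<in> K \<longleftrightarrow> 1 \<le> cmod (psl_act D z)" if "z \<in> UHP" for z
    unfolding A(3) using A(1) B that
    by (subst mem_act_image_iff) (auto simp: D_def psl_act_mult psl_act_closed)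
  have "{C \<in> carrier PSL2Z. (psl_act C zeta \<in> K) \<noteq> (psl_act C omega \<in> K)} \<subseteq> (\<lambda>C. inv\<^bsub>PSL2Z\<^esub> D \<otimes>\<^bsub>PSL2Z\<^esub> C) ` ?X"
  proof
    fix C assume C: "C \<in> {C \<in> carrier PSL2Z. (psl_act C zeta \<in> K) \<noteq> (psl_act C omega \<in> K)}"
    then have "D \<otimes>\<^bsub>PSL2Z\<^esub> C \<in> ?X"
      using D K[of "psl_act C zeta"] K[of "psl_act C omega"] by (auto simp: psl_act_closed psl_act_mult)
    moreover have "C = inv\<^bsub>PSL2Z\<^esub> D \<otimes>\<^bsub>PSL2Z\<^esub> (D \<otimes>\<^bsub>PSL2Z\<^esub> C)" using C D by (simp flip: m_assoc)
    ultimately show "C \<in> (\<lambda>C. inv\<^bsub>PSL2Z\<^esub> D \<otimes>\<^bsub>PSL2Z\<^esub> C) ` ?X" by blast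
  qed
  then show ?thesis using finite_edges_crossing_unit_circle by (meson finite_imageI finite_subset)
qed

lemma finite_edges_leaving_piece:
  assumes "polyhedral_piece S"
  shows "finite {C \<in> carrier PSL2Z. (psl_act C zeta \<in> S) \<noteq> (psl_act C omega \<in> S)}"
proof -
  from assms obtain F where F: "finite F" "F \<subseteq> halfplanes" "S = Omega \<inter> (UHP \<inter> \<Inter>F)"
    by (auto simp: polyhedral_piece_def convex_polyhedral_def)
  have "{C \<in> carrier PSL2Z. (psl_act C zeta \<in> S) \<noteq> (psl_act C omega \<in> S)} \<subseteq>
      (\<Union>K\<in>F. {C \<in> carrier PSL2Z. (psl_act C zeta \<in> K) \<noteq> (psl_act C omega \<in> K)})"
    unfolding F(3) by (auto simp: psl_act_Omega psl_act_closed)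
  moreover have "finite (\<Union>K\<in>F. {C \<in> carrier PSL2Z. (psl_act C zeta \<in> K) \<noteq> (psl_act C omega \<in> K)})"
    using F finite_edges_crossing_halfplane by blast
  ultimately show ?thesis by (rule finite_subset)
qed

section \<open>Piecewise isometries respect almost all edges and links\<close>

lemma piecewise_isometric_imp_tree_isometric:
  assumes "piecewise_isometric g"
  shows "finite {E \<in> tree_edges. \<not> respects_edge g E}" "finite {v \<in> Omega. \<not> respects_link g v}"
proof -
  interpret group PSL2Z by (rule group_PSL2Z)
  from assms obtain \<S> c where S: "finite \<S>" "\<Union>\<S> = Omega"
    "\<And>S. S \<in> \<S> \<Longrightarrow> polyhedral_piece S" "\<And>S. S \<in> \<S> \<Longrightarrow> c S \<in> carrier PSL2Z"
    "\<And>S z. S \<in> \<S> \<Longrightarrow> z \<in> S \<Longrightarrow> g z = psl_act (c S) z"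
    by (rule piecewise_isometricE) blast
  \<comment> \<open>The oriented edges with ends separated by some piece. An edge outside
    \<open>G\<close> has both ends in one piece, where \<open>g\<close> is a single group
    element.\<close>
  define G where "G = (\<Union>S\<in>\<S>. {C \<in> carrier PSL2Z. (psl_act C zeta \<in> S) \<noteq> (psl_act C omega \<in> S)})"
  have G: "finite G" unfolding G_def using S(1,3) finite_edges_leaving_piece by blast
  have "{E \<in> tree_edges. \<not> respects_edge g E} \<subseteq> (\<lambda>C. psl_act C ` base_edge) ` G"
  proof
    fix E assume E: "E \<in> {E \<in> tree_edges. \<not> respects_edge g E}"
    then obtain C where C: "C \<in> carrier PSL2Z" "E = psl_act C ` base_edge" by (auto simp: tree_edges_def)
    have "respects_edge g E" if "C \<notin> G"
    proof -
      obtain S where S': "S \<in> \<S>" "psl_act C zeta \<in> S" using S(2) psl_act_Omega[OF C(1) zeta_Omega] by blast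
      then have "psl_act C omega \<in> S" using that C(1) by (auto simp: G_def)
      then have "g ` edge_ends E = edge_ends (psl_act (c S \<otimes>\<^bsub>PSL2Z\<^esub> C) ` base_edge)"
        using C S' S(4,5) by (simp add: edge_ends_act psl_act_mult)
      moreover have "psl_act (c S \<otimes>\<^bsub>PSL2Z\<^esub> C) ` base_edge \<in> tree_edges"
        using S(4)[OF S'(1)] C(1) by (auto simp: tree_edges_def)
      ultimately show ?thesis unfolding respects_edge_def by blast
    qed
    then show "E \<in> (\<lambda>C. psl_act C ` base_edge) ` G" using E C by blast
  qed
  then show "finite {E \<in> tree_edges. \<not> respects_edge g E}" using G finite_surj by blast
  have "{v \<in> Omega. \<not> respects_link g v} \<subseteq> (\<lambda>C. psl_act C zeta) ` G"
  proof
    fix v assume v: "v \<in> {v \<in> Omega. \<not> respects_link g v}"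
    have "respects_link g v" if nG: "v \<notin> (\<lambda>C. psl_act C zeta) ` G"
      unfolding respects_link_def
    proof (intro allI impI)
      fix x y z assume "link_ccw v x y z"
      then obtain C where C: "C \<in> carrier PSL2Z" "v = psl_act C zeta" "x = psl_act C omega"
        "y = psl_act C (psl_act rot omega)" "z = psl_act C (psl_act rot (psl_act rot omega))"
        unfolding link_ccw_iff by blast
      obtain S where S': "S \<in> \<S>" "v \<in> S" using S(2) v by blast
      \<comment> \<open>No oriented edge starting at \<open>v\<close> lies in \<open>G\<close>, so
        the piece containing \<open>v\<close> contains all its neighbours.\<close>
      have nb: "psl_act D omega \<in> S" if "D \<in> carrier PSL2Z" "psl_act D zeta = v" for D
        using that S' nG unfolding G_def by blast
      have "x \<in> S" using nb C by simp
      moreover have "y \<in> S" using nb[of "C \<otimes>\<^bsub>PSL2Z\<^esub> rot"] C by (simp add: psl_act_mult generator_values(1))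
      moreover have "z \<in> S" using nb[of "C \<otimes>\<^bsub>PSL2Z\<^esub> rot \<otimes>\<^bsub>PSL2Z\<^esub> rot"] C
        by (simp add: psl_act_mult psl_act_closed generator_values(1))
      ultimately have "g v = psl_act (c S) v" "g x = psl_act (c S) x" "g y = psl_act (c S) y" "g z = psl_act (c S) z"
        using S(5) S' by blast+
      then show "link_ccw (g v) (g x) (g y) (g z)"
        unfolding link_ccw_iff using C S(4)[OF S'(1)]
        by (intro bexI[of _ "c S \<otimes>\<^bsub>PSL2Z\<^esub> C"]) (simp_all add: psl_act_mult psl_act_closed)
    qed
    then show "v \<in> (\<lambda>C. psl_act C zeta) ` G" using v by blast
  qed
  then show "finite {v \<in> Omega. \<not> respects_link g v}" using G finite_surj by blast
qed

section \<open>Covering branches by pieces\<close>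

text \<open>A local form of \<open>piecewise_isometric\<close>. The pieces may extend beyond
  \<open>X\<close>, which makes the notion inherited by subsets and finite unions.\<close>

definition covered :: "(complex \<Rightarrow> complex) \<Rightarrow> complex set \<Rightarrow> bool" where
  "covered g X \<longleftrightarrow> (\<exists>\<S>. finite \<S> \<and> X \<subseteq> \<Union>\<S> \<and>
     (\<forall>S\<in>\<S>. polyhedral_piece S \<and> (\<exists>C\<in>carrier PSL2Z. \<forall>z\<in>S. g z = psl_act C z)))"

lemma covered_mono: "covered g Y \<Longrightarrow> X \<subseteq> Y \<Longrightarrow> covered g X"
  unfolding covered_def by (meson subset_trans)

lemma covered_Un:
  assumes "covered g X" "covered g Y"
  shows "covered g (X \<union> Y)"
proof -
  let ?P = "\<lambda>S. polyhedral_piece S \<and> (\<exists>C\<in>carrier PSL2Z. \<forall>z\<in>S. g z = psl_act C z)"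
  from assms obtain \<S> \<T> where "finite \<S>" "X \<subseteq> \<Union>\<S>" "\<forall>S\<in>\<S>. ?P S" "finite \<T>" "Y \<subseteq> \<Union>\<T>" "\<forall>S\<in>\<T>. ?P S"
    unfolding covered_def by blast
  then show ?thesis unfolding covered_def by (intro exI[of _ "\<S> \<union> \<T>"]) auto
qed

lemma covered_piece:
  assumes "polyhedral_piece S" "C \<in> carrier PSL2Z" "\<And>z. z \<in> S \<Longrightarrow> g z = psl_act C z"
  shows "covered g S"
  unfolding covered_def using assms by (intro exI[of _ "{S}"]) auto

lemma covered_Omega:
  assumes "covered g Omega"
  shows "piecewise_isometric g"
proof -
  let ?P = "\<lambda>S. polyhedral_piece S \<and> (\<exists>C\<in>carrier PSL2Z. \<forall>z\<in>S. g z = psl_act C z)"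
  from assms obtain \<S> where S: "finite \<S>" "Omega \<subseteq> \<Union>\<S>" "\<forall>S\<in>\<S>. ?P S"
    unfolding covered_def by blast
  then have "\<Union>\<S> \<subseteq> Omega" unfolding polyhedral_piece_def by blast
  with S show ?thesis unfolding piecewise_isometric_def by (intro exI[of _ \<S>]) auto
qed

section \<open>Vertices and half-trees as pieces, and agreement with group elements on them\<close>

lemma base_halfplanes_halfplanes: "K \<in> base_halfplanes \<Longrightarrow> K \<in> halfplanes"
proof -
  assume K: "K \<in> base_halfplanes"
  then have "psl_act \<one>\<^bsub>PSL2Z\<^esub> ` K = K"
    using psl_act_one by (auto simp: base_halfplanes_def image_iff)
  then show "K \<in> halfplanes"
    unfolding halfplanes_def using K group.is_monoid[OF group_PSL2Z] monoid.one_closed by blast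
qed

lemma translated_halfplanes:
  "{z \<in> UHP. 1 \<le> cmod (z - 1)} \<in> halfplanes" "{z \<in> UHP. 1 / 2 \<le> Re z} \<in> halfplanes"
proof -
  have t: "psl_act (mob 1 1 0 1) ` {z \<in> UHP. P z} = {z \<in> UHP. P (z - 1)}" for P
  proof -
    have "z \<in> psl_act (mob 1 1 0 1) ` {z \<in> UHP. P z}" if "z \<in> UHP" "P (z - 1)" for z
      by (rule image_eqI[of _ _ "z - 1"]) (use that in \<open>simp_all add: psl_act_mob UHP_iff\<close>)
    moreover have "psl_act (mob 1 1 0 1) z \<in> {z \<in> UHP. P (z - 1)}" if "z \<in> UHP" "P z" for z
      using that by (simp add: psl_act_mob UHP_iff)
    ultimately show ?thesis by blast
  qed
  have C: "mob 1 1 0 1 \<in> carrier PSL2Z" by (simp add: mob_carrier)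
  have "{z \<in> UHP. 1 \<le> cmod z} \<in> halfplanes" "{z \<in> UHP. - 1 / 2 \<le> Re z} \<in> halfplanes"
    by (rule base_halfplanes_halfplanes, simp add: base_halfplanes_def)+
  moreover have "- 1 / 2 \<le> Re (z - 1) \<longleftrightarrow> 1 / 2 \<le> Re z" for z by auto
  ultimately show "{z \<in> UHP. 1 \<le> cmod (z - 1)} \<in> halfplanes" "{z \<in> UHP. 1 / 2 \<le> Re z} \<in> halfplanes"
    using halfplanes_translate[OF C, of "{z \<in> UHP. 1 \<le> cmod z}"]
      halfplanes_translate[OF C, of "{z \<in> UHP. - 1 / 2 \<le> Re z}"]
    unfolding t by simp_all
qed

lemma polyhedral_piece_branch: "polyhedral_piece branch"
proof -
  let ?F = "{{z \<in> UHP. Re z \<le> 1 / 2}, {z \<in> UHP. 1 \<le> cmod (z - 1)}}"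
  have "{z \<in> UHP. Re z \<le> 1 / 2} \<in> halfplanes"
    by (rule base_halfplanes_halfplanes) (simp add: base_halfplanes_def)
  moreover have "branch = Omega \<inter> (UHP \<inter> \<Inter>?F)" by (auto simp: branch_def Omega_UHP)
  ultimately show ?thesis
    unfolding polyhedral_piece_def convex_polyhedral_def using translated_halfplanes(1)
    by (intro exI[of _ "UHP \<inter> \<Inter>?F"] exI[of _ ?F] conjI refl) auto
qed

text \<open>On the line \<open>Re z = 1 / 2\<close>, the only vertex with
  \<open>1 \<le> cmod z\<close> is \<open>zeta\<close>. With this, single vertices can be split off
  a half-tree as pieces.\<close>

lemma polyhedral_piece_zeta: "polyhedral_piece {zeta}"
proof -
  let ?F = "{{z \<in> UHP. 1 \<le> cmod z}, {z \<in> UHP. Re z \<le> 1 / 2}, {z \<in> UHP. 1 / 2 \<le> Re z}}"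
  have "{z \<in> UHP. Re z \<le> 1 / 2} \<in> halfplanes" "{z \<in> UHP. 1 \<le> cmod z} \<in> halfplanes"
    by (rule base_halfplanes_halfplanes, simp add: base_halfplanes_def)+
  moreover have "Omega \<inter> (UHP \<inter> \<Inter>?F) = {zeta}"
  proof
    show "Omega \<inter> (UHP \<inter> \<Inter>?F) \<subseteq> {zeta}"
    proof
      fix z assume z: "z \<in> Omega \<inter> (UHP \<inter> \<Inter>?F)"
      then have x: "Re z = 1 / 2" by auto
      with z have "z = zeta \<or> z = omega" by (intro Omega_fundamental) auto
      with x show "z \<in> {zeta}" by (auto simp: omega_eq)
    qed
    have "cmod zeta = 1" by (simp add: zeta_def)
    moreover have "Re zeta = 1 / 2" by (simp add: zeta_eq)
    ultimately show "{zeta} \<subseteq> Omega \<inter> (UHP \<inter> \<Inter>?F)" by simp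
  qed
  ultimately show ?thesis
    unfolding polyhedral_piece_def convex_polyhedral_def using translated_halfplanes(2)
    by (intro exI[of _ "UHP \<inter> \<Inter>?F"] exI[of _ ?F] conjI refl) auto
qed

lemma Omega_transitive:
  assumes "v \<in> Omega" "w \<in> Omega"
  obtains C where "C \<in> carrier PSL2Z" "w = psl_act C v"
proof -
  interpret group PSL2Z by (rule group_PSL2Z)
  obtain A where "A \<in> carrier PSL2Z" "v = psl_act A zeta" using assms(1) by (rule Omega_cases)
  moreover obtain B where "B \<in> carrier PSL2Z" "w = psl_act B zeta" using assms(2) by (rule Omega_cases)
  ultimately show thesis
    by (intro that[of "B \<otimes>\<^bsub>PSL2Z\<^esub> inv\<^bsub>PSL2Z\<^esub> A"]) (simp_all add: psl_act_mult psl_act_closed psl_act_inv)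
qed

lemma covered_vertex:
  assumes "v \<in> Omega" "g v \<in> Omega"
  shows "covered g {v}"
proof -
  obtain A where A: "A \<in> carrier PSL2Z" "v = psl_act A zeta" using assms(1) by (rule Omega_cases)
  then have "polyhedral_piece {v}" using polyhedral_piece_translate[OF A(1) polyhedral_piece_zeta] by simp
  moreover obtain C where "C \<in> carrier PSL2Z" "g v = psl_act C v" using assms by (rule Omega_transitive)
  ultimately show ?thesis using covered_piece by auto
qed

text \<open>The link of \<open>C omega\<close> is \<open>C zeta\<close>,
  \<open>C (left omega)\<close>, \<open>C (right omega)\<close> in counterclockwise order. Its image
  is again a counterclockwise link, and two known values, at the vertex and at one neighbour,
  determine the other two.\<close>

lemma respects_link_children:
  assumes "C \<in> carrier PSL2Z" "D \<in> carrier PSL2Z" "respects_link g (psl_act C omega)"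
    and "g (psl_act C zeta) = psl_act D zeta" "g (psl_act C omega) = psl_act D omega"
  shows "g (psl_act C (psl_act left omega)) = psl_act D (psl_act left omega) \<and>
    g (psl_act C (psl_act right omega)) = psl_act D (psl_act right omega)"
proof -
  interpret group PSL2Z by (rule group_PSL2Z)
  note flips = generator_values(2,3,8,9)
  have act_flip: "psl_act (A \<otimes>\<^bsub>PSL2Z\<^esub> flip) z = psl_act A (psl_act flip z)"
    if "A \<in> carrier PSL2Z" "z \<in> UHP" for A z using that by (simp add: psl_act_mult)
  have U: "psl_act rot omega \<in> UHP" "psl_act rot (psl_act rot omega) \<in> UHP" by (simp_all add: psl_act_closed)
  have "link_ccw (psl_act C omega) (psl_act C zeta) (psl_act C (psl_act left omega)) (psl_act C (psl_act right omega))"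
    unfolding link_ccw_iff using assms(1) U
    by (intro bexI[of _ "C \<otimes>\<^bsub>PSL2Z\<^esub> flip"]) (simp_all add: act_flip flips)
  then have "link_ccw (psl_act D omega) (psl_act D zeta)
      (g (psl_act C (psl_act left omega))) (g (psl_act C (psl_act right omega)))"
    using assms(3-5) unfolding respects_link_def by metis
  then obtain A where A: "A \<in> carrier PSL2Z" "psl_act D omega = psl_act A zeta" "psl_act D zeta = psl_act A omega"
    "g (psl_act C (psl_act left omega)) = psl_act A (psl_act rot omega)"
    "g (psl_act C (psl_act right omega)) = psl_act A (psl_act rot (psl_act rot omega))"
    unfolding link_ccw_iff by blast
  \<comment> \<open>\<open>A\<close> describes the image link; it agrees with \<open>D\<close> after
    \<open>flip\<close> on the base edge, hence everywhere.\<close>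
  have "psl_act A z = psl_act (D \<otimes>\<^bsub>PSL2Z\<^esub> flip) z" if "z \<in> UHP" for z
    by (rule edge_determines_act) (use A(1-3) assms(2) that in \<open>simp_all add: act_flip flips\<close>)
  then show ?thesis using A(4,5) assms(2) U by (simp add: act_flip flips)
qed

text \<open>Induction on a bound for the height. A vertex other than \<open>zeta\<close> is
  \<open>G w\<close> with \<open>G\<close> one of \<open>left\<close>, \<open>right\<close> and
  \<open>w\<close> of height smaller by at least 1, and the induction hypothesis applies to
  \<open>w\<close> with \<open>C G\<close> and \<open>D G\<close> in place of \<open>C\<close> and
  \<open>D\<close>.\<close>

lemma respects_branch:
  assumes "x \<in> branch" "height x < real n" "C \<in> carrier PSL2Z" "D \<in> carrier PSL2Z"
    and "\<forall>y\<in>branch. respects_link g (psl_act C y)"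
    and "g (psl_act C zeta) = psl_act D zeta" "g (psl_act C omega) = psl_act D omega"
  shows "g (psl_act C x) = psl_act D x"
  using assms
proof (induction n arbitrary: x C D)
  case 0
  then show ?case using height_nonneg branchD(2) by fastforce
next
  case (Suc n)
  interpret group PSL2Z by (rule group_PSL2Z)
  have "omega \<in> branch" using left_branch[OF zeta_branch] by (simp add: generator_values)
  then have ch: "g (psl_act C (psl_act left omega)) = psl_act D (psl_act left omega)"
    "g (psl_act C (psl_act right omega)) = psl_act D (psl_act right omega)"
    using respects_link_children Suc.prems by blast+
  have step: "g (psl_act C (psl_act G w)) = psl_act D (psl_act G w)"
    if w: "w \<in> branch" "height w < real n" and G: "G \<in> carrier PSL2Z" "psl_act G zeta = omega"
      "\<And>y. y \<in> branch \<Longrightarrow> psl_act G y \<in> branch"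
      "g (psl_act C (psl_act G omega)) = psl_act D (psl_act G omega)" for G w
  proof -
    have e: "psl_act (A \<otimes>\<^bsub>PSL2Z\<^esub> G) z = psl_act A (psl_act G z)" if "A \<in> carrier PSL2Z" "z \<in> UHP" for A z
      using that G(1) by (simp add: psl_act_mult)
    have "g (psl_act (C \<otimes>\<^bsub>PSL2Z\<^esub> G) w) = psl_act (D \<otimes>\<^bsub>PSL2Z\<^esub> G) w"
    proof (rule Suc.IH[OF w])
      show "\<forall>y\<in>branch. respects_link g (psl_act (C \<otimes>\<^bsub>PSL2Z\<^esub> G) y)"
        using Suc.prems(3,5) G(3) by (simp add: e branchD)
    qed (use Suc.prems G in \<open>simp_all add: e\<close>)
    then show ?thesis using Suc.prems w by (simp add: e branchD)
  qed
  from Suc.prems(1) show ?case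
  proof (cases rule: branch_cases)
    case 1
    then show ?thesis using Suc.prems by simp
  next
    case (2 w)
    then show ?thesis
      using step[of w left] height_left[of w] Suc.prems(2) left_branch ch(1) by (simp add: generator_values)
  next
    case (3 w)
    then show ?thesis
      using step[of w right] height_right[of w] Suc.prems(2) right_branch ch(2) by (simp add: generator_values)
  qed
qed

text \<open>Induction on a bound \<open>n\<close> for the heights of vertices with broken links. At
  0 the whole half-tree is one piece; otherwise it is a vertex and two smaller half-trees, in whose
  own coordinates the bound drops by 1.\<close>

lemma covered_branch:
  assumes "g \<in> Omega \<rightarrow> Omega" "C \<in> carrier PSL2Z"
    and "\<forall>y\<in>branch. real n \<le> height y \<longrightarrow> respects_link g (psl_act C y)"
  shows "covered g (psl_act C ` branch)"
  using assms(2,3)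
proof (induction n arbitrary: C)
  case 0
  interpret group PSL2Z by (rule group_PSL2Z)
  have good: "\<forall>y\<in>branch. respects_link g (psl_act C y)"
    using 0 height_nonneg branchD(2) by simp
  \<comment> \<open>The respected link at \<open>C zeta\<close> supplies the element
    \<open>D\<close> that agrees with \<open>g\<close> on the first edge.\<close>
  have "link_ccw (psl_act C zeta) (psl_act C omega) (psl_act C (psl_act rot omega)) (psl_act C (psl_act rot (psl_act rot omega)))"
    unfolding link_ccw_iff using 0(1) by blast
  with good zeta_branch have "link_ccw (g (psl_act C zeta)) (g (psl_act C omega))
      (g (psl_act C (psl_act rot omega))) (g (psl_act C (psl_act rot (psl_act rot omega))))"
    unfolding respects_link_def by blast
  then obtain D where D: "D \<in> carrier PSL2Z" "g (psl_act C zeta) = psl_act D zeta" "g (psl_act C omega) = psl_act D omega"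
    unfolding link_ccw_iff by blast
  have *: "g (psl_act C x) = psl_act D x" if x: "x \<in> branch" for x
  proof -
    obtain m where "height x < real m" using reals_Archimedean2 by blast
    then show ?thesis using respects_branch x 0(1) D good by blast
  qed
  show ?case
  proof (rule covered_piece)
    show "polyhedral_piece (psl_act C ` branch)"
      using 0(1) polyhedral_piece_branch by (rule polyhedral_piece_translate)
    show "D \<otimes>\<^bsub>PSL2Z\<^esub> inv\<^bsub>PSL2Z\<^esub> C \<in> carrier PSL2Z" using D 0 by simp
    show "g z = psl_act (D \<otimes>\<^bsub>PSL2Z\<^esub> inv\<^bsub>PSL2Z\<^esub> C) z" if "z \<in> psl_act C ` branch" for z
      using that D 0(1) * by (auto simp: psl_act_mult psl_act_closed psl_act_inv branchD)
  qed
next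
  case (Suc n)
  interpret group PSL2Z by (rule group_PSL2Z)
  have step: "covered g (psl_act C ` psl_act G ` branch)"
    if G: "G \<in> carrier PSL2Z" "\<And>y. y \<in> branch \<Longrightarrow> psl_act G y \<in> branch"
      "\<And>y. y \<in> branch \<Longrightarrow> height y + 1 \<le> height (psl_act G y)" for G
  proof -
    have "branch \<subseteq> UHP" using branchD(2) by blast
    then have "psl_act (C \<otimes>\<^bsub>PSL2Z\<^esub> G) ` branch = psl_act C ` psl_act G ` branch"
      using Suc.prems(1) G(1) by (simp add: act_mult_image)
    moreover have "covered g (psl_act (C \<otimes>\<^bsub>PSL2Z\<^esub> G) ` branch)"
    proof (rule Suc.IH)
      show "\<forall>y\<in>branch. real n \<le> height y \<longrightarrow> respects_link g (psl_act (C \<otimes>\<^bsub>PSL2Z\<^esub> G) y)"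
      proof (intro ballI impI)
        fix y assume y: "y \<in> branch" "real n \<le> height y"
        then have "real (Suc n) \<le> height (psl_act G y)" using G(3)[OF y(1)] by simp
        then show "respects_link g (psl_act (C \<otimes>\<^bsub>PSL2Z\<^esub> G) y)"
          using Suc.prems G(1,2) y(1) by (simp add: psl_act_mult branchD)
      qed
    qed (use Suc.prems G in simp)
    ultimately show ?thesis by simp
  qed
  have "covered g {psl_act C zeta}"
    using Suc.prems(1) assms(1) psl_act_Omega zeta_Omega by (intro covered_vertex) blast+
  moreover have "covered g (psl_act C ` psl_act left ` branch)"
    using left_branch height_left by (intro step) simp_all
  moreover have "covered g (psl_act C ` psl_act right ` branch)"
    using right_branch height_right by (intro step) simp_all
  ultimately have "covered g ({psl_act C zeta} \<union> psl_act C ` psl_act left ` branch \<union> psl_act C ` psl_act right ` branch)"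
    by (intro covered_Un)
  moreover have "branch \<subseteq> {zeta} \<union> psl_act left ` branch \<union> psl_act right ` branch"
    using branch_cases by blast
  then have "psl_act C ` branch \<subseteq>
      {psl_act C zeta} \<union> psl_act C ` psl_act left ` branch \<union> psl_act C ` psl_act right ` branch"
    by blast
  ultimately show ?case by (rule covered_mono)
qed

lemma tree_isometric_imp_piecewise_isometric:
  assumes "g \<in> Omega \<rightarrow> Omega" "finite {v \<in> Omega. \<not> respects_link g v}"
  shows "piecewise_isometric g"
proof (rule covered_Omega)
  interpret group PSL2Z by (rule group_PSL2Z)
  have cov: "covered g (psl_act C ` branch)" if C: "C \<in> carrier PSL2Z" for C
  proof -
    \<comment> \<open>Heights of the finitely many exceptional vertices in the coordinates of
      \<open>C\<close>; any natural number above them starts the induction.\<close>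
    let ?H = "(\<lambda>v. height (psl_act (inv\<^bsub>PSL2Z\<^esub> C) v)) ` {v \<in> Omega. \<not> respects_link g v}"
    have "bdd_above ?H" using assms(2) by (intro bdd_above_finite finite_imageI)
    then obtain b where b: "\<And>h. h \<in> ?H \<Longrightarrow> h \<le> b" by (auto simp: bdd_above_def)
    obtain n where n: "b < real n" using reals_Archimedean2 by blast
    have "respects_link g (psl_act C y)" if y: "y \<in> branch" "real n \<le> height y" for y
    proof (rule ccontr)
      assume "\<not> ?thesis"
      then have "height (psl_act (inv\<^bsub>PSL2Z\<^esub> C) (psl_act C y)) \<in> ?H"
        using psl_act_Omega[OF C] branchD(1)[OF y(1)] by blast
      then show False using b n y psl_act_inv(1)[OF C] branchD(2)[OF y(1)] by fastforce
    qed
    then show ?thesis using covered_branch[OF assms(1) C] by blast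
  qed
  have "Omega \<subseteq> psl_act \<one>\<^bsub>PSL2Z\<^esub> ` branch \<union> psl_act rot ` branch \<union> psl_act (rot \<otimes>\<^bsub>PSL2Z\<^esub> rot) ` branch"
  proof
    fix z assume z: "z \<in> Omega"
    then have U: "z \<in> UHP" "psl_act rot z \<in> UHP" by (simp_all add: Omega_UHP psl_act_closed)
    have "z = psl_act \<one>\<^bsub>PSL2Z\<^esub> z" "z = psl_act (rot \<otimes>\<^bsub>PSL2Z\<^esub> rot) (psl_act rot z)"
      "z = psl_act rot (psl_act rot (psl_act rot z))"
      using U by (simp_all add: psl_act_one psl_act_mult rot_cube)
    with Omega_branches[OF z] show "z \<in> psl_act \<one>\<^bsub>PSL2Z\<^esub> ` branch \<union> psl_act rot ` branch \<union> psl_act (rot \<otimes>\<^bsub>PSL2Z\<^esub> rot) ` branch"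
      by blast
  qed
  then show "covered g Omega"
    by (rule covered_mono[rotated]) (intro covered_Un cov; simp)
qed

theorem theorem2p2:
  shows "phi = ppti"
proof -
  have "piecewise_isometric g \<longleftrightarrow>
      finite {E \<in> tree_edges. \<not> respects_edge g E} \<and> finite {v \<in> Omega. \<not> respects_link g v}"
    if "g \<in> carrier (BijGroup Omega)" for g
  proof -
    have "g \<in> Omega \<rightarrow> Omega" using that Bij_imp_funcset by (simp add: BijGroup_def)
    then show ?thesis
      using piecewise_isometric_imp_tree_isometric tree_isometric_imp_piecewise_isometric by blast
  qed
  then have "{g \<in> carrier (BijGroup Omega). piecewise_isometric g} = {g \<in> carrier (BijGroup Omega).
      finite {E \<in> tree_edges. \<not> respects_edge g E} \<and> finite {v \<in> Omega. \<not> respects_link g v}}"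
    by blast
  then show ?thesis unfolding phi_def ppti_def by (simp only:)
qed

end
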